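(* Let $R$ be an arbitrary associative unitary ring and let $L:\mathrm{Mod}(R)\to \mathbb{R}_{\geq 0}\cup\{\infty\}$ be a length function. Then the restriction $\mathrm{ent}_L:\mathrm{lFin}_L[X]\to \mathbb{R}_{\geq 0}\cup\{\infty\}$ of the algebraic $L$-entropy is additive; that is, for every $M_\phi\in \mathrm{lFin}_L[X]$ and every $R[X]$-submodule $N_{\phi\restriction_N}\leq M_\phi$, with $\bar\phi: M/N\to M/N$ the map induced by $\phi$, $$\mathrm{ent}_L(\phi)=\mathrm{ent}_L(\phi\restriction_N)+\mathrm{ent}_L(\bar\phi).$$ Hence $\mathrm{ent}_L$ is a length function on $\mathrm{lFin}_L[X]$.
   Context: $\mathrm{Mod}(R)$ is the category of right $R$-modules. A function $L:\mathrm{Mod}(R)\to \mathbb{R}_{\geq 0}\cup\{\infty\}$ is a length function if: $L(0)=0$ and $L(M)=L(M')$ whenever $M\cong M'$ (invariant); $L(M)=L(M')+L(M'')$ for every short exact sequence $0\to M'\to M\to M''\to 0$ (additive); and $L(M)=\sup\{L(F): F \text{ a finitely generated submodule of } M\}$ for all $M$ (upper continuous). $L$ is not assumed discrete. A module $N$ is $L$-finite if $L(N)<\infty$; $\mathrm{Fin}_L(M)$ is the set of $L$-finite submodules of $M$. A module is locally $L$-finite if all its finitely generated submodules are $L$-finite. $M_\phi$, with $M$ a right $R$-module and $\phi\in\mathrm{End}_R(M)$, denotes the right $R[X]$-module with underlying $R$-module $M$ on which $X$ acts as $\phi$. $\mathrm{lFin}_L[X]$ is the full subcategory of $\mathrm{Mod}(R[X])$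 consisting of the $M_\phi$ with $M$ locally $L$-finite as an $R$-module. A length function on $\mathrm{lFin}_L[X]$ is a function to $\mathbb{R}_{\ge 0}\cup\{\infty\}$ that is an invariant, is additive on short exact sequences of $R[X]$-modules in $\mathrm{lFin}_L[X]$, and is upper continuous with respect to finitely generated $R[X]$-submodules. For $N\in\mathrm{Fin}_L(M)$ and $n\geq 1$ let $T_n(\phi,N)=\sum_{i=0}^{n-1}\phi^i(N)$. The limit $\mathrm{ent}_L(\phi,N)=\lim_{n\to\infty}L(T_n(\phi,N))/n$ exists and is finite (Fekete's Lemma). The algebraic $L$-entropy is $\mathrm{ent}_L(M_\phi)=\mathrm{ent}_L(\phi)=\sup\{\mathrm{ent}_L(\phi,N): N\in\mathrm{Fin}_L(M)\}$. *)

theory Defs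
  imports "HOL-Algebra.UnivPoly" "HOL-Library.Extended_Nonnegative_Real" "HOL.Hull"
begin

section \<open>Right modules over an associative unital ring\<close>

text \<open>The locale \<^locale>\<open>module\<close> of HOL-Algebra requires a commutative ring of scalars, so
  right modules over an arbitrary ring are introduced here. As in HOL-Algebra, the fields \<open>mult\<close>
  and \<open>one\<close> inherited from the ring record play no role.\<close>

record ('r, 'm) rmod = "'m ring" +
  ract :: "'m \<Rightarrow> 'r \<Rightarrow> 'm" (infixl \<open>\<cdot>\<index>\<close> 70)

locale rmodule = R?: ring R + M?: abelian_group M
  for R :: "('r, 'k) ring_scheme" (structure) and M :: "('r, 'm) rmod" (structure) +
  assumes ract_closed [simp, intro]:
      "\<lbrakk>x \<in> carrier M; r \<in> carrier R\<rbrakk> \<Longrightarrow> x \<cdot>\<^bsub>M\<^esub> r \<in> carrier M"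
    and ract_l_distr:
      "\<lbrakk>x \<in> carrier M; y \<in> carrier M; r \<in> carrier R\<rbrakk>
        \<Longrightarrow> (x \<oplus>\<^bsub>M\<^esub> y) \<cdot>\<^bsub>M\<^esub> r = x \<cdot>\<^bsub>M\<^esub> r \<oplus>\<^bsub>M\<^esub> y \<cdot>\<^bsub>M\<^esub> r"
    and ract_r_distr:
      "\<lbrakk>x \<in> carrier M; r \<in> carrier R; s \<in> carrier R\<rbrakk>
        \<Longrightarrow> x \<cdot>\<^bsub>M\<^esub> (r \<oplus>\<^bsub>R\<^esub> s) = x \<cdot>\<^bsub>M\<^esub> r \<oplus>\<^bsub>M\<^esub> x \<cdot>\<^bsub>M\<^esub> s"
    and ract_assoc:
      "\<lbrakk>x \<in> carrier M; r \<in> carrier R; s \<in> carrier R\<rbrakk>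
        \<Longrightarrow> x \<cdot>\<^bsub>M\<^esub> (r \<otimes>\<^bsub>R\<^esub> s) = (x \<cdot>\<^bsub>M\<^esub> r) \<cdot>\<^bsub>M\<^esub> s"
    and ract_one [simp]: "x \<in> carrier M \<Longrightarrow> x \<cdot>\<^bsub>M\<^esub> \<one>\<^bsub>R\<^esub> = x"

text \<open>The category of right modules is a proper class, while HOL can only quantify over modules
  whose elements lie in one type. The type \<open>'m\<close> is therefore an arbitrary universe and \<open>Right_Mod R\<close>
  consists of the right modules with carrier inside \<open>'m\<close>. It contains, up to isomorphism, all
  submodules and quotients of its members. Nothing is assumed about \<open>'m\<close>.\<close>

definition Right_Mod :: "('r, 'k) ring_scheme \<Rightarrow> ('r, 'm) rmod set" where
  "Right_Mod R = {M. rmodule R M}"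

definition rsubmodule :: "('r, 'k) ring_scheme \<Rightarrow> ('r, 'm) rmod \<Rightarrow> 'm set \<Rightarrow> bool" where
  "rsubmodule R M N \<longleftrightarrow>
     additive_subgroup N M \<and> (\<forall>x\<in>N. \<forall>r\<in>carrier R. x \<cdot>\<^bsub>M\<^esub> r \<in> N)"

text \<open>A submodule \<open>N\<close>, regarded as a module of its own, is \<open>M\<lparr>carrier := N\<rparr>\<close>.\<close>

definition fg_submodule :: "('r, 'k) ring_scheme \<Rightarrow> ('r, 'm) rmod \<Rightarrow> 'm set \<Rightarrow> bool" where
  "fg_submodule R M F \<longleftrightarrow>
     (\<exists>A. finite A \<and> A \<subseteq> carrier M \<and> F = rsubmodule R M hull A)"

definition rmod_hom ::
  "('r, 'k) ring_scheme \<Rightarrow> ('r, 'm) rmod \<Rightarrow> ('r, 'n) rmod \<Rightarrow> ('m \<Rightarrow> 'n) set" where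
  "rmod_hom R M N = {h. h \<in> carrier M \<rightarrow> carrier N \<and>
     (\<forall>x\<in>carrier M. \<forall>y\<in>carrier M. h (x \<oplus>\<^bsub>M\<^esub> y) = h x \<oplus>\<^bsub>N\<^esub> h y) \<and>
     (\<forall>x\<in>carrier M. \<forall>r\<in>carrier R. h (x \<cdot>\<^bsub>M\<^esub> r) = h x \<cdot>\<^bsub>N\<^esub> r)}"

definition rmod_iso :: "('r, 'k) ring_scheme \<Rightarrow> ('r, 'm) rmod \<Rightarrow> ('r, 'n) rmod \<Rightarrow> bool" where
  "rmod_iso R M N \<longleftrightarrow> (\<exists>h\<in>rmod_hom R M N. bij_betw h (carrier M) (carrier N))"

definition short_exact ::
  "('r, 'k) ring_scheme \<Rightarrow> ('r, 'm) rmod \<Rightarrow> ('r, 'm) rmod \<Rightarrow> ('r, 'm) rmod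
    \<Rightarrow> ('m \<Rightarrow> 'm) \<Rightarrow> ('m \<Rightarrow> 'm) \<Rightarrow> bool" where
  "short_exact R M' M M'' f g \<longleftrightarrow>
     f \<in> rmod_hom R M' M \<and> g \<in> rmod_hom R M M'' \<and>
     inj_on f (carrier M') \<and> g ` carrier M = carrier M'' \<and>
     f ` carrier M' = {x \<in> carrier M. g x = \<zero>\<^bsub>M''\<^esub>}"

text \<open>The usual quotient has carrier type \<open>'m set\<close> and so lies outside the universe \<open>'m\<close>. Instead,
  every coset is replaced by one chosen element of it; see
  \<open>quot_rmod_is_quotient\<close> below.\<close>

definition coset_rep :: "('r, 'm) rmod \<Rightarrow> 'm set \<Rightarrow> 'm \<Rightarrow> 'm" where
  "coset_rep M N x = (SOME y. y \<in> N +>\<^bsub>M\<^esub> x)"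

definition quot_rmod :: "('r, 'm) rmod \<Rightarrow> 'm set \<Rightarrow> ('r, 'm) rmod" where
  "quot_rmod M N =
     \<lparr>carrier = coset_rep M N ` carrier M, mult = mult M, one = one M,
      zero = coset_rep M N \<zero>\<^bsub>M\<^esub>,
      add = (\<lambda>x y. coset_rep M N (x \<oplus>\<^bsub>M\<^esub> y)),
      ract = (\<lambda>x r. coset_rep M N (x \<cdot>\<^bsub>M\<^esub> r))\<rparr>"

definition quot_map :: "('r, 'm) rmod \<Rightarrow> 'm set \<Rightarrow> ('m \<Rightarrow> 'm) \<Rightarrow> 'm \<Rightarrow> 'm" where
  "quot_map M N \<phi> = (\<lambda>x. coset_rep M N (\<phi> x))"


section \<open>Length functions\<close>

text \<open>A length function on a class \<open>\<C>\<close> of right \<open>S\<close>-modules. It is applied with \<open>\<C> = Right_Mod S\<close> and with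
  the class \<open>lFinX\<close> below.\<close>

definition length_function ::
  "('s, 'k) ring_scheme \<Rightarrow> ('s, 'm) rmod set \<Rightarrow> (('s, 'm) rmod \<Rightarrow> ennreal) \<Rightarrow> bool" where
  "length_function S \<C> L \<longleftrightarrow>
     (\<forall>M\<in>\<C>. carrier M = {\<zero>\<^bsub>M\<^esub>} \<longrightarrow> L M = 0) \<and>
     (\<forall>M\<in>\<C>. \<forall>M'\<in>\<C>. rmod_iso S M M' \<longrightarrow> L M = L M') \<and>
     (\<forall>M'\<in>\<C>. \<forall>M\<in>\<C>. \<forall>M''\<in>\<C>. \<forall>f g. short_exact S M' M M'' f g \<longrightarrow> L M = L M' + L M'') \<and>
     (\<forall>M\<in>\<C>. L M = (SUP F\<in>{F. fg_submodule S M F}. L (M\<lparr>carrier := F\<rparr>)))"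

definition Fin ::
  "('r, 'k) ring_scheme \<Rightarrow> (('r, 'm) rmod \<Rightarrow> ennreal) \<Rightarrow> ('r, 'm) rmod \<Rightarrow> 'm set set" where
  "Fin R L M = {N. rsubmodule R M N \<and> L (M\<lparr>carrier := N\<rparr>) < \<infinity>}"

definition locally_finite ::
  "('r, 'k) ring_scheme \<Rightarrow> (('r, 'm) rmod \<Rightarrow> ennreal) \<Rightarrow> ('r, 'm) rmod \<Rightarrow> bool" where
  "locally_finite R L M \<longleftrightarrow> (\<forall>F. fg_submodule R M F \<longrightarrow> L (M\<lparr>carrier := F\<rparr>) < \<infinity>)"


section \<open>Algebraic entropy of an endomorphism\<close>

text \<open>\<open>trajectory M \<phi> N n\<close> is the sum of the submodules \<open>(\<phi> ^^ i) ` N\<close> for \<open>i < n\<close>.\<close>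

definition trajectory :: "('r, 'm) rmod \<Rightarrow> ('m \<Rightarrow> 'm) \<Rightarrow> 'm set \<Rightarrow> nat \<Rightarrow> 'm set" where
  "trajectory M \<phi> N n =
     {\<Oplus>\<^bsub>M\<^esub>i\<in>{..<n}. x i | x. \<forall>i<n. x i \<in> (\<phi> ^^ i) ` N}"

definition ent_at ::
  "(('r, 'm) rmod \<Rightarrow> ennreal) \<Rightarrow> ('r, 'm) rmod \<Rightarrow> ('m \<Rightarrow> 'm) \<Rightarrow> 'm set \<Rightarrow> ennreal" where
  "ent_at L M \<phi> N = lim (\<lambda>n. L (M\<lparr>carrier := trajectory M \<phi> N n\<rparr>) / of_nat n)"

definition ent ::
  "('r, 'k) ring_scheme \<Rightarrow> (('r, 'm) rmod \<Rightarrow> ennreal) \<Rightarrow> ('r, 'm) rmod \<Rightarrow> ('m \<Rightarrow> 'm) \<Rightarrow> ennreal"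
  where "ent R L M \<phi> = (SUP N\<in>Fin R L M. ent_at L M \<phi> N)"


section \<open>Right modules over the polynomial ring\<close>

text \<open>\<open>UP R\<close> is the polynomial ring \<open>R[X]\<close> with a central variable. The module \<open>M\<^sub>\<phi>\<close> has the
  underlying \<open>R\<close>-module \<open>M\<close>, with \<open>X\<close> acting as \<open>\<phi>\<close>.\<close>

definition poly_rmod ::
  "('r, 'k) ring_scheme \<Rightarrow> ('r, 'm) rmod \<Rightarrow> ('m \<Rightarrow> 'm) \<Rightarrow> (nat \<Rightarrow> 'r, 'm) rmod" where
  "poly_rmod R M \<phi> =
     \<lparr>carrier = carrier M, mult = mult M, one = one M, zero = zero M, add = add M,
      ract = (\<lambda>x p. \<Oplus>\<^bsub>M\<^esub>i\<in>{..deg R p}. (\<phi> ^^ i) (x \<cdot>\<^bsub>M\<^esub> coeff (UP R) p i))\<rparr>"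

text \<open>Conversely, every right \<open>R[X]\<close>-module \<open>V\<close> is \<open>M\<^sub>\<phi>\<close> for its underlying \<open>R\<close>-module
  \<open>M = base_rmod R V\<close> and the endomorphism \<open>\<phi> = X_act R V\<close> given by the action of \<open>X\<close>;
  see \<open>poly_rmod_base\<close> and \<open>poly_rmodule_eq\<close> below.\<close>

definition base_rmod ::
  "('r, 'k) ring_scheme \<Rightarrow> (nat \<Rightarrow> 'r, 'm) rmod \<Rightarrow> ('r, 'm) rmod" where
  "base_rmod R V =
     \<lparr>carrier = carrier V, mult = mult V, one = one V, zero = zero V, add = add V,
      ract = (\<lambda>x r. x \<cdot>\<^bsub>V\<^esub> monom (UP R) r 0)\<rparr>"

definition X_act :: "('r, 'k) ring_scheme \<Rightarrow> (nat \<Rightarrow> 'r, 'm) rmod \<Rightarrow> 'm \<Rightarrow> 'm" where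
  "X_act R V x = x \<cdot>\<^bsub>V\<^esub> monom (UP R) \<one>\<^bsub>R\<^esub> 1"

definition lFinX ::
  "('r, 'k) ring_scheme \<Rightarrow> (('r, 'm) rmod \<Rightarrow> ennreal) \<Rightarrow> (nat \<Rightarrow> 'r, 'm) rmod set" where
  "lFinX R L = {V \<in> Right_Mod (UP R). locally_finite R L (base_rmod R V)}"

definition entX ::
  "('r, 'k) ring_scheme \<Rightarrow> (('r, 'm) rmod \<Rightarrow> ennreal) \<Rightarrow> (nat \<Rightarrow> 'r, 'm) rmod \<Rightarrow> ennreal" where
  "entX R L V = ent R L (base_rmod R V) (X_act R V)"


section \<open>Adequacy of the encodings\<close>

context rmodule
begin

lemma coset_rep_in:
  assumes "rsubmodule R M N" "x \<in> carrier M"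
  shows "coset_rep M N x \<in> N +>\<^bsub>M\<^esub> x" "coset_rep M N x \<in> carrier M"
proof -
  have N: "additive_subgroup N M" using assms(1) by (simp add: rsubmodule_def)
  then interpret A: additive_subgroup N M .
  have "\<zero>\<^bsub>M\<^esub> \<oplus>\<^bsub>M\<^esub> x \<in> N +>\<^bsub>M\<^esub> x"
    using A.zero_closed by (auto simp: a_r_coset_def')
  then show *: "coset_rep M N x \<in> N +>\<^bsub>M\<^esub> x"
    unfolding coset_rep_def by (rule someI)
  show "coset_rep M N x \<in> carrier M"
    using * assms(2) A.a_subset by (auto simp: a_r_coset_def')
qed

lemma coset_rep_diff:
  assumes "rsubmodule R M N" "x \<in> carrier M"
  obtains a where "a \<in> N" "a \<in> carrier M" "coset_rep M N x = a \<oplus>\<^bsub>M\<^esub> x"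
proof -
  obtain a where "a \<in> N" "coset_rep M N x = a \<oplus>\<^bsub>M\<^esub> x"
    using coset_rep_in(1)[OF assms] unfolding a_r_coset_def' by blast
  moreover have "N \<subseteq> carrier M"
    using assms(1) by (simp add: rsubmodule_def additive_subgroup.a_subset)
  ultimately show thesis using that by blast
qed

lemma coset_rep_shift:
  assumes "rsubmodule R M N" "x \<in> carrier M" "a \<in> N"
  shows "coset_rep M N (a \<oplus>\<^bsub>M\<^esub> x) = coset_rep M N x"
proof -
  have N: "additive_subgroup N M" using assms(1) by (simp add: rsubmodule_def)
  then interpret A: additive_subgroup N M .
  have "abelian_subgroup N M" by (rule abelian_subgroupI3[OF N M.abelian_group_axioms])
  then interpret AS: abelian_subgroup N M .
  have "a \<oplus>\<^bsub>M\<^esub> x \<in> N +>\<^bsub>M\<^esub> x" using assms(3) by (auto simp: a_r_coset_def')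
  then have "N +>\<^bsub>M\<^esub> x = N +>\<^bsub>M\<^esub> (a \<oplus>\<^bsub>M\<^esub> x)"
    using assms by (intro AS.a_repr_independence'[of _ x]) auto
  then show ?thesis by (simp add: coset_rep_def)
qed

lemma coset_rep_rep:
  assumes "rsubmodule R M N" "x \<in> carrier M"
  shows "coset_rep M N (coset_rep M N x) = coset_rep M N x"
proof -
  obtain a where "a \<in> N" "coset_rep M N x = a \<oplus>\<^bsub>M\<^esub> x" using coset_rep_diff[OF assms] .
  then show ?thesis using coset_rep_shift[OF assms] by simp
qed

lemma coset_rep_add:
  assumes N: "rsubmodule R M N" and x: "x \<in> carrier M" and y: "y \<in> carrier M"
  shows "coset_rep M N (coset_rep M N x \<oplus>\<^bsub>M\<^esub> coset_rep M N y) = coset_rep M N (x \<oplus>\<^bsub>M\<^esub> y)"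
proof -
  obtain a where a: "a \<in> N" "a \<in> carrier M" "coset_rep M N x = a \<oplus>\<^bsub>M\<^esub> x"
    using coset_rep_diff[OF N x] .
  obtain b where b: "b \<in> N" "b \<in> carrier M" "coset_rep M N y = b \<oplus>\<^bsub>M\<^esub> y"
    using coset_rep_diff[OF N y] .
  have "a \<oplus>\<^bsub>M\<^esub> b \<in> N"
    using N a b by (simp add: rsubmodule_def additive_subgroup.a_closed)
  moreover have "coset_rep M N x \<oplus>\<^bsub>M\<^esub> coset_rep M N y = (a \<oplus>\<^bsub>M\<^esub> b) \<oplus>\<^bsub>M\<^esub> (x \<oplus>\<^bsub>M\<^esub> y)"
    using a b x y by (simp add: M.a_ac)
  ultimately show ?thesis using coset_rep_shift[OF N] x y by simp
qed

lemma coset_rep_ract: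
  assumes N: "rsubmodule R M N" and x: "x \<in> carrier M" and r: "r \<in> carrier R"
  shows "coset_rep M N (coset_rep M N x \<cdot>\<^bsub>M\<^esub> r) = coset_rep M N (x \<cdot>\<^bsub>M\<^esub> r)"
proof -
  obtain a where a: "a \<in> N" "a \<in> carrier M" "coset_rep M N x = a \<oplus>\<^bsub>M\<^esub> x"
    using coset_rep_diff[OF N x] .
  have "a \<cdot>\<^bsub>M\<^esub> r \<in> N" using N a r by (simp add: rsubmodule_def)
  then show ?thesis using coset_rep_shift[OF N] a x r by (simp add: ract_l_distr)
qed

lemma quot_rmod_is_rmodule:
  assumes N: "rsubmodule R M N"
  shows "rmodule R (quot_rmod M N)"
proof -
  note [simp] = coset_rep_add[OF N] coset_rep_ract[OF N] coset_rep_rep[OF N] coset_rep_in(2)[OF N]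
  have l: "coset_rep M N (coset_rep M N x \<oplus>\<^bsub>M\<^esub> y) = coset_rep M N (x \<oplus>\<^bsub>M\<^esub> y)"
    if "x \<in> carrier M" "y \<in> carrier M" for x y
    using that coset_rep_add[OF N, of "coset_rep M N x" y] by simp
  have r: "coset_rep M N (x \<oplus>\<^bsub>M\<^esub> coset_rep M N y) = coset_rep M N (x \<oplus>\<^bsub>M\<^esub> y)"
    if "x \<in> carrier M" "y \<in> carrier M" for x y
    using that coset_rep_add[OF N, of x "coset_rep M N y"] by simp
  have "abelian_group (quot_rmod M N)"
  proof (rule abelian_groupI)
    fix x assume "x \<in> carrier (quot_rmod M N)"
    then obtain x0 where x0: "x0 \<in> carrier M" "x = coset_rep M N x0" by (auto simp: quot_rmod_def)
    then show "\<exists>y\<in>carrier (quot_rmod M N). y \<oplus>\<^bsub>quot_rmod M N\<^esub> x = \<zero>\<^bsub>quot_rmod M N\<^esub>"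
      by (intro bexI[of _ "coset_rep M N (\<ominus>\<^bsub>M\<^esub> x0)"]) (auto simp: quot_rmod_def M.l_neg)
  qed (auto simp: quot_rmod_def l r M.a_assoc, simp add: M.a_comm)
  moreover have "coset_rep M N (coset_rep M N x \<cdot>\<^bsub>M\<^esub> r \<oplus>\<^bsub>M\<^esub> coset_rep M N x \<cdot>\<^bsub>M\<^esub> s)
      = coset_rep M N (x \<cdot>\<^bsub>M\<^esub> r \<oplus>\<^bsub>M\<^esub> x \<cdot>\<^bsub>M\<^esub> s)"
    if "x \<in> carrier M" "r \<in> carrier R" "s \<in> carrier R" for x r s
    using that coset_rep_add[OF N, of "coset_rep M N x \<cdot>\<^bsub>M\<^esub> r" "coset_rep M N x \<cdot>\<^bsub>M\<^esub> s"] by simp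
  moreover have "coset_rep M N (coset_rep M N x \<cdot>\<^bsub>M\<^esub> r \<cdot>\<^bsub>M\<^esub> s) = coset_rep M N (x \<cdot>\<^bsub>M\<^esub> r \<cdot>\<^bsub>M\<^esub> s)"
    if "x \<in> carrier M" "r \<in> carrier R" "s \<in> carrier R" for x r s
    using that coset_rep_ract[OF N, of "coset_rep M N x \<cdot>\<^bsub>M\<^esub> r" s] by simp
  ultimately show ?thesis
    by (intro rmodule.intro ring_axioms rmodule_axioms.intro)
       (auto simp: quot_rmod_def ract_l_distr ract_r_distr ract_assoc)
qed

lemma quot_rmod_is_quotient:
  assumes N: "rsubmodule R M N"
  shows "coset_rep M N \<in> rmod_hom R M (quot_rmod M N)"
    and "coset_rep M N ` carrier M = carrier (quot_rmod M N)"
    and "{x \<in> carrier M. coset_rep M N x = \<zero>\<^bsub>quot_rmod M N\<^esub>} = N"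
proof -
  show "coset_rep M N \<in> rmod_hom R M (quot_rmod M N)"
    by (auto simp: rmod_hom_def quot_rmod_def coset_rep_add[OF N] coset_rep_ract[OF N])
  show "coset_rep M N ` carrier M = carrier (quot_rmod M N)" by (simp add: quot_rmod_def)
  have A: "additive_subgroup N M" using N by (simp add: rsubmodule_def)
  interpret A: additive_subgroup N M by (rule A)
  have "x \<in> N" if x: "x \<in> carrier M" and e: "coset_rep M N x = coset_rep M N \<zero>\<^bsub>M\<^esub>" for x
  proof -
    obtain a where a: "a \<in> N" "a \<in> carrier M" "coset_rep M N x = a \<oplus>\<^bsub>M\<^esub> x"
      using coset_rep_diff[OF N x] .
    obtain b where b: "b \<in> N" "b \<in> carrier M" "coset_rep M N \<zero>\<^bsub>M\<^esub> = b \<oplus>\<^bsub>M\<^esub> \<zero>\<^bsub>M\<^esub>"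
      using coset_rep_diff[OF N M.zero_closed] .
    have "x = \<ominus>\<^bsub>M\<^esub> a \<oplus>\<^bsub>M\<^esub> (a \<oplus>\<^bsub>M\<^esub> x)" using a x by (simp add: M.r_neg1)
    also have "\<dots> = \<ominus>\<^bsub>M\<^esub> a \<oplus>\<^bsub>M\<^esub> b" using a b e by simp
    finally show ?thesis using a b by simp
  qed
  moreover have "coset_rep M N x = coset_rep M N \<zero>\<^bsub>M\<^esub>" if "x \<in> N" for x
  proof -
    have "x \<in> carrier M" using that A.a_subset by blast
    then show ?thesis using coset_rep_shift[OF N M.zero_closed that] by simp
  qed
  ultimately show "{x \<in> carrier M. coset_rep M N x = \<zero>\<^bsub>quot_rmod M N\<^esub>} = N"
    using A.a_subset unfolding quot_rmod_def ring.simps by blast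
qed

lemma quot_map_coset_rep:
  assumes N: "rsubmodule R M N" and \<phi>: "\<phi> \<in> rmod_hom R M M" and inv: "\<phi> ` N \<subseteq> N"
    and x: "x \<in> carrier M"
  shows "quot_map M N \<phi> (coset_rep M N x) = coset_rep M N (\<phi> x)"
proof -
  obtain a where a: "a \<in> N" "a \<in> carrier M" "coset_rep M N x = a \<oplus>\<^bsub>M\<^esub> x"
    using coset_rep_diff[OF N x] .
  have "\<phi> (a \<oplus>\<^bsub>M\<^esub> x) = \<phi> a \<oplus>\<^bsub>M\<^esub> \<phi> x" "\<phi> x \<in> carrier M"
    using \<phi> a x by (auto simp: rmod_hom_def)
  then show ?thesis using coset_rep_shift[OF N, of "\<phi> x" "\<phi> a"] a inv by (auto simp: quot_map_def)
qed

lemma hom_finsum: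
  assumes "h \<in> rmod_hom R M M" "f \<in> A \<rightarrow> carrier M"
  shows "h (\<Oplus>\<^bsub>M\<^esub>i\<in>A. f i) = (\<Oplus>\<^bsub>M\<^esub>i\<in>A. h (f i))"
proof -
  have z: "h \<zero>\<^bsub>M\<^esub> = \<zero>\<^bsub>M\<^esub>"
  proof -
    have "h \<zero>\<^bsub>M\<^esub> \<in> carrier M" "h (\<zero>\<^bsub>M\<^esub> \<oplus>\<^bsub>M\<^esub> \<zero>\<^bsub>M\<^esub>) = h \<zero>\<^bsub>M\<^esub> \<oplus>\<^bsub>M\<^esub> h \<zero>\<^bsub>M\<^esub>"
      using assms(1) M.zero_closed unfolding rmod_hom_def by blast+
    then show ?thesis by (metis M.add.r_cancel_one' M.l_zero M.zero_closed)
  qed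
  show ?thesis using assms(2)
  proof (induction A rule: infinite_finite_induct)
    case (insert a A)
    then have "f a \<in> carrier M" "f \<in> A \<rightarrow> carrier M" by auto
    moreover from this have "(\<lambda>i. h (f i)) \<in> A \<rightarrow> carrier M" "h (f a) \<in> carrier M"
      using assms(1) by (auto simp: rmod_hom_def)
    ultimately show ?case using insert assms(1)
      by (simp add: M.finsum_insert) (simp add: rmod_hom_def)
  qed (simp_all add: z)
qed

lemma ract_finsum_left:
  assumes "r \<in> carrier R" "f \<in> A \<rightarrow> carrier M"
  shows "(\<Oplus>\<^bsub>M\<^esub>i\<in>A. f i) \<cdot>\<^bsub>M\<^esub> r = (\<Oplus>\<^bsub>M\<^esub>i\<in>A. f i \<cdot>\<^bsub>M\<^esub> r)"
proof -
  have z: "\<zero>\<^bsub>M\<^esub> \<cdot>\<^bsub>M\<^esub> r = \<zero>\<^bsub>M\<^esub>"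
    using ract_l_distr[of "\<zero>\<^bsub>M\<^esub>" "\<zero>\<^bsub>M\<^esub>" r] assms(1)
    by (metis M.add.r_cancel_one' M.l_zero M.zero_closed ract_closed)
  show ?thesis using assms(2)
  proof (induction A rule: infinite_finite_induct)
    case (insert a A)
    then have "f a \<in> carrier M" "f \<in> A \<rightarrow> carrier M" by auto
    moreover from this have "(\<lambda>i. f i \<cdot>\<^bsub>M\<^esub> r) \<in> A \<rightarrow> carrier M" "f a \<cdot>\<^bsub>M\<^esub> r \<in> carrier M"
      using assms(1) by auto
    ultimately show ?case using insert assms(1)
      by (simp add: M.finsum_insert ract_l_distr)
  qed (simp_all add: z)
qed

lemma ract_zero: "x \<in> carrier M \<Longrightarrow> x \<cdot>\<^bsub>M\<^esub> \<zero>\<^bsub>R\<^esub> = \<zero>\<^bsub>M\<^esub>"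
  using ract_r_distr[of x "\<zero>\<^bsub>R\<^esub>" "\<zero>\<^bsub>R\<^esub>"]
  by (metis M.add.r_cancel_one' R.l_zero R.zero_closed ract_closed)

lemma ract_finsum_right:
  assumes "x \<in> carrier M" "f \<in> A \<rightarrow> carrier R"
  shows "x \<cdot>\<^bsub>M\<^esub> (\<Oplus>\<^bsub>R\<^esub>i\<in>A. f i) = (\<Oplus>\<^bsub>M\<^esub>i\<in>A. x \<cdot>\<^bsub>M\<^esub> f i)"
  using assms(2)
proof (induction A rule: infinite_finite_induct)
  case (insert a A)
  then have "f a \<in> carrier R" "f \<in> A \<rightarrow> carrier R" by auto
  moreover from this have "(\<lambda>i. x \<cdot>\<^bsub>M\<^esub> f i) \<in> A \<rightarrow> carrier M" "x \<cdot>\<^bsub>M\<^esub> f a \<in> carrier M"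
    using assms(1) by auto
  ultimately show ?case using insert assms(1)
    by (simp add: M.finsum_insert R.finsum_insert ract_r_distr)
qed (use assms in \<open>simp_all add: ract_zero\<close>)

lemma funpow_hom:
  assumes "\<phi> \<in> rmod_hom R M M" shows "(\<phi> ^^ i) \<in> rmod_hom R M M"
  by (induction i) (use assms in \<open>auto simp: rmod_hom_def Pi_def\<close>)

lemma finsum_triangle:
  fixes h :: "nat \<Rightarrow> nat \<Rightarrow> 'm"
  assumes "\<And>i j. h i j \<in> carrier M"
  shows "(\<Oplus>\<^bsub>M\<^esub>k\<in>{..n}. \<Oplus>\<^bsub>M\<^esub>i\<in>{..k}. h i (k - i)) = (\<Oplus>\<^bsub>M\<^esub>i\<in>{..n}. \<Oplus>\<^bsub>M\<^esub>j\<in>{..n - i}. h i j)"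
proof (induction n)
  case 0 then show ?case using assms by (simp add: Pi_def)
next
  case (Suc n)
  have "(\<Oplus>\<^bsub>M\<^esub>i\<in>{..Suc n}. \<Oplus>\<^bsub>M\<^esub>j\<in>{..Suc n - i}. h i j)
      = h (Suc n) 0 \<oplus>\<^bsub>M\<^esub> (\<Oplus>\<^bsub>M\<^esub>i\<in>{..n}. \<Oplus>\<^bsub>M\<^esub>j\<in>{..Suc n - i}. h i j)"
    using assms by (simp add: Pi_def)
  also have "(\<Oplus>\<^bsub>M\<^esub>i\<in>{..n}. \<Oplus>\<^bsub>M\<^esub>j\<in>{..Suc n - i}. h i j)
      = (\<Oplus>\<^bsub>M\<^esub>i\<in>{..n}. h i (Suc n - i) \<oplus>\<^bsub>M\<^esub> (\<Oplus>\<^bsub>M\<^esub>j\<in>{..n - i}. h i j))"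
    by (rule M.finsum_cong') (use assms in \<open>auto simp: Suc_diff_le Pi_def\<close>)
  also have "\<dots> = (\<Oplus>\<^bsub>M\<^esub>i\<in>{..n}. h i (Suc n - i)) \<oplus>\<^bsub>M\<^esub> (\<Oplus>\<^bsub>M\<^esub>i\<in>{..n}. \<Oplus>\<^bsub>M\<^esub>j\<in>{..n - i}. h i j)"
    by (rule M.finsum_addf) (use assms in \<open>auto simp: Pi_def\<close>)
  finally show ?case using assms Suc by (simp add: Pi_def M.a_assoc)
qed

lemma finsum_swap:
  fixes h :: "nat \<Rightarrow> nat \<Rightarrow> 'm"
  assumes h: "\<And>i j. h i j \<in> carrier M"
  shows "(\<Oplus>\<^bsub>M\<^esub>i\<in>{..m}. \<Oplus>\<^bsub>M\<^esub>j\<in>{..n}. h i j) = (\<Oplus>\<^bsub>M\<^esub>j\<in>{..n}. \<Oplus>\<^bsub>M\<^esub>i\<in>{..m}. h i j)"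
proof (induction m)
  case 0
  have "(\<Oplus>\<^bsub>M\<^esub>i\<in>{..0}. \<Oplus>\<^bsub>M\<^esub>j\<in>{..n}. h i j) = (\<Oplus>\<^bsub>M\<^esub>j\<in>{..n}. h 0 j)"
    by (rule M.finsum_0) (use h in \<open>auto intro!: M.finsum_closed\<close>)
  also have "\<dots> = (\<Oplus>\<^bsub>M\<^esub>j\<in>{..n}. \<Oplus>\<^bsub>M\<^esub>i\<in>{..0}. h i j)"
    by (rule M.finsum_cong'[OF refl]) (use h in \<open>auto intro!: M.finsum_closed\<close>)
  finally show ?case .
next
  case (Suc m)
  have "(\<Oplus>\<^bsub>M\<^esub>j\<in>{..n}. \<Oplus>\<^bsub>M\<^esub>i\<in>{..Suc m}. h i j)
      = (\<Oplus>\<^bsub>M\<^esub>j\<in>{..n}. h (Suc m) j \<oplus>\<^bsub>M\<^esub> (\<Oplus>\<^bsub>M\<^esub>i\<in>{..m}. h i j))"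
    by (rule M.finsum_cong'[OF refl]) (use h in \<open>auto intro!: M.finsum_closed M.finsum_Suc\<close>)
  also have "\<dots> = (\<Oplus>\<^bsub>M\<^esub>j\<in>{..n}. h (Suc m) j) \<oplus>\<^bsub>M\<^esub> (\<Oplus>\<^bsub>M\<^esub>j\<in>{..n}. \<Oplus>\<^bsub>M\<^esub>i\<in>{..m}. h i j)"
    by (rule M.finsum_addf) (use h in \<open>auto intro!: M.finsum_closed\<close>)
  also have "\<dots> = (\<Oplus>\<^bsub>M\<^esub>i\<in>{..Suc m}. \<Oplus>\<^bsub>M\<^esub>j\<in>{..n}. h i j)"
    unfolding Suc[symmetric]
    by (rule M.finsum_Suc[symmetric]) (use h in \<open>auto intro!: M.finsum_closed\<close>)
  finally show ?case by simp
qed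

lemma poly_ract_bound:
  assumes \<phi>: "\<phi> \<in> rmod_hom R M M" and x: "x \<in> carrier M" and p: "p \<in> carrier (UP R)"
    and n: "deg R p \<le> n"
  shows "x \<cdot>\<^bsub>poly_rmod R M \<phi>\<^esub> p = (\<Oplus>\<^bsub>M\<^esub>i\<in>{..n}. (\<phi> ^^ i) (x \<cdot>\<^bsub>M\<^esub> coeff (UP R) p i))"
proof -
  interpret U: UP_ring R "UP R" by unfold_locales
  have c: "(\<phi> ^^ i) y \<in> carrier M" if "y \<in> carrier M" for i y
    using funpow_hom[OF \<phi>, of i] that by (auto simp: rmod_hom_def)
  have z: "(\<phi> ^^ i) (x \<cdot>\<^bsub>M\<^esub> coeff (UP R) p i) = \<zero>\<^bsub>M\<^esub>" if "deg R p < i" for i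
    using hom_finsum[OF funpow_hom[OF \<phi>], of _ "{}" i] U.deg_aboveD[OF that p] x
    by (simp add: ract_zero)
  show ?thesis unfolding poly_rmod_def rmod.simps
    by (rule M.add.finprod_mono_neutral_cong_left) (use n x p z c in auto)
qed

lemma poly_rmod_is_rmodule:
  assumes \<phi>: "\<phi> \<in> rmod_hom R M M"
  shows "rmodule (UP R) (poly_rmod R M \<phi>)"
proof -
  interpret U: UP_ring R "UP R" by unfold_locales
  let ?P = "poly_rmod R M \<phi>"
  have sel: "carrier ?P = carrier M" "add ?P = add M" "zero ?P = zero M"
    by (simp_all add: poly_rmod_def)
  have c: "(\<phi> ^^ i) y \<in> carrier M" if "y \<in> carrier M" for i y
    using funpow_hom[OF \<phi>, of i] that by (auto simp: rmod_hom_def)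
  have ca: "(\<phi> ^^ i) (x \<oplus>\<^bsub>M\<^esub> y) = (\<phi> ^^ i) x \<oplus>\<^bsub>M\<^esub> (\<phi> ^^ i) y"
    if "x \<in> carrier M" "y \<in> carrier M" for i x y
    using funpow_hom[OF \<phi>, of i] that by (auto simp: rmod_hom_def)
  have cr: "(\<phi> ^^ i) x \<cdot>\<^bsub>M\<^esub> r = (\<phi> ^^ i) (x \<cdot>\<^bsub>M\<^esub> r)"
    if "x \<in> carrier M" "r \<in> carrier R" for i x r
    using funpow_hom[OF \<phi>, of i] that by (auto simp: rmod_hom_def)
  have cl: "x \<cdot>\<^bsub>?P\<^esub> p \<in> carrier M" if "x \<in> carrier M" "p \<in> carrier (UP R)" for x p
    unfolding poly_ract_bound[OF \<phi> that order_refl]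
    by (rule M.finsum_closed) (use that c in auto)
  have cz: "(\<phi> ^^ i) \<zero>\<^bsub>M\<^esub> = \<zero>\<^bsub>M\<^esub>" for i
    using hom_finsum[OF funpow_hom[OF \<phi>], of _ "{}" i] by simp
  have ab: "abelian_group ?P"
    by (rule abelian_groupI) (auto simp: sel M.a_ac intro: M.add.l_inv_ex)
  have ass: "x \<cdot>\<^bsub>?P\<^esub> (p \<otimes>\<^bsub>UP R\<^esub> q) = (x \<cdot>\<^bsub>?P\<^esub> p) \<cdot>\<^bsub>?P\<^esub> q"
    if x: "x \<in> carrier M" and p: "p \<in> carrier (UP R)" and q: "q \<in> carrier (UP R)" for x p q
  proof -
    define n where "n = deg R p + deg R q + deg R (p \<otimes>\<^bsub>UP R\<^esub> q)"
    let ?h = "\<lambda>i j. (\<phi> ^^ (i + j)) (x \<cdot>\<^bsub>M\<^esub> (coeff (UP R) p i \<otimes>\<^bsub>R\<^esub> coeff (UP R) q j))"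
    have hc: "?h i j \<in> carrier M" for i j using c x p q by simp
    have hz: "?h i j = \<zero>\<^bsub>M\<^esub>" if "i + j > n" for i j
    proof -
      have "deg R p < i \<or> deg R q < j" using that by (auto simp: n_def)
      then have "coeff (UP R) p i \<otimes>\<^bsub>R\<^esub> coeff (UP R) q j = \<zero>\<^bsub>R\<^esub>"
        using U.deg_aboveD p q by auto
      then show ?thesis using x by (simp add: ract_zero cz)
    qed
    have "x \<cdot>\<^bsub>?P\<^esub> (p \<otimes>\<^bsub>UP R\<^esub> q)
        = (\<Oplus>\<^bsub>M\<^esub>k\<in>{..n}. (\<phi> ^^ k) (x \<cdot>\<^bsub>M\<^esub> coeff (UP R) (p \<otimes>\<^bsub>UP R\<^esub> q) k))"
      by (rule poly_ract_bound[OF \<phi> x]) (use p q in \<open>auto simp: n_def\<close>)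
    also have "\<dots> = (\<Oplus>\<^bsub>M\<^esub>k\<in>{..n}. \<Oplus>\<^bsub>M\<^esub>i\<in>{..k}. ?h i (k - i))"
    proof (rule M.finsum_cong'[OF refl])
      fix k
      have "x \<cdot>\<^bsub>M\<^esub> coeff (UP R) (p \<otimes>\<^bsub>UP R\<^esub> q) k
          = (\<Oplus>\<^bsub>M\<^esub>i\<in>{..k}. x \<cdot>\<^bsub>M\<^esub> (coeff (UP R) p i \<otimes>\<^bsub>R\<^esub> coeff (UP R) q (k - i)))"
        using x p q by (simp add: ract_finsum_right Pi_def)
      also have "(\<phi> ^^ k) \<dots>
          = (\<Oplus>\<^bsub>M\<^esub>i\<in>{..k}. (\<phi> ^^ k) (x \<cdot>\<^bsub>M\<^esub> (coeff (UP R) p i \<otimes>\<^bsub>R\<^esub> coeff (UP R) q (k - i))))"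
        by (rule hom_finsum[OF funpow_hom[OF \<phi>]]) (use x p q in auto)
      also have "\<dots> = (\<Oplus>\<^bsub>M\<^esub>i\<in>{..k}. ?h i (k - i))"
        by (rule M.finsum_cong') (use hc in auto)
      finally show "(\<phi> ^^ k) (x \<cdot>\<^bsub>M\<^esub> coeff (UP R) (p \<otimes>\<^bsub>UP R\<^esub> q) k)
          = (\<Oplus>\<^bsub>M\<^esub>i\<in>{..k}. ?h i (k - i))" .
    qed (use hc in \<open>auto intro!: M.finsum_closed\<close>)
    also have "\<dots> = (\<Oplus>\<^bsub>M\<^esub>i\<in>{..n}. \<Oplus>\<^bsub>M\<^esub>j\<in>{..n - i}. ?h i j)"
      by (rule finsum_triangle) (rule hc)
    also have "\<dots> = (\<Oplus>\<^bsub>M\<^esub>i\<in>{..n}. \<Oplus>\<^bsub>M\<^esub>j\<in>{..n}. ?h i j)"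
      by (intro M.finsum_cong'[OF refl] M.add.finprod_mono_neutral_cong_left)
         (use hc in \<open>auto intro!: hz M.finsum_closed\<close>)
    also have "\<dots> = (\<Oplus>\<^bsub>M\<^esub>j\<in>{..n}. \<Oplus>\<^bsub>M\<^esub>i\<in>{..n}. ?h i j)"
      by (rule finsum_swap) (rule hc)
    also have "\<dots> = (\<Oplus>\<^bsub>M\<^esub>j\<in>{..n}. (\<phi> ^^ j) ((x \<cdot>\<^bsub>?P\<^esub> p) \<cdot>\<^bsub>M\<^esub> coeff (UP R) q j))"
    proof (rule M.finsum_cong'[OF refl])
      fix j
      have xp: "x \<cdot>\<^bsub>?P\<^esub> p = (\<Oplus>\<^bsub>M\<^esub>i\<in>{..n}. (\<phi> ^^ i) (x \<cdot>\<^bsub>M\<^esub> coeff (UP R) p i))"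
        by (rule poly_ract_bound[OF \<phi> x p]) (simp add: n_def)
      have "(x \<cdot>\<^bsub>?P\<^esub> p) \<cdot>\<^bsub>M\<^esub> coeff (UP R) q j
          = (\<Oplus>\<^bsub>M\<^esub>i\<in>{..n}. (\<phi> ^^ i) (x \<cdot>\<^bsub>M\<^esub> coeff (UP R) p i) \<cdot>\<^bsub>M\<^esub> coeff (UP R) q j)"
        unfolding xp by (rule ract_finsum_left) (use x p q c in auto)
      also have "(\<phi> ^^ j) \<dots>
          = (\<Oplus>\<^bsub>M\<^esub>i\<in>{..n}. (\<phi> ^^ j) ((\<phi> ^^ i) (x \<cdot>\<^bsub>M\<^esub> coeff (UP R) p i) \<cdot>\<^bsub>M\<^esub> coeff (UP R) q j))"
        by (rule hom_finsum[OF funpow_hom[OF \<phi>]]) (use x p q c in auto)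
      also have "\<dots> = (\<Oplus>\<^bsub>M\<^esub>i\<in>{..n}. ?h i j)"
      proof (rule M.finsum_cong'[OF refl])
        fix i
        show "(\<phi> ^^ j) ((\<phi> ^^ i) (x \<cdot>\<^bsub>M\<^esub> coeff (UP R) p i) \<cdot>\<^bsub>M\<^esub> coeff (UP R) q j) = ?h i j"
          using x p q by (simp add: cr ract_assoc add.commute[of i j] funpow_add)
      qed (use hc in auto)
      finally show "(\<Oplus>\<^bsub>M\<^esub>i\<in>{..n}. ?h i j)
          = (\<phi> ^^ j) ((x \<cdot>\<^bsub>?P\<^esub> p) \<cdot>\<^bsub>M\<^esub> coeff (UP R) q j)" by simp
    qed (use x p q c cl in auto)
    also have "\<dots> = (x \<cdot>\<^bsub>?P\<^esub> p) \<cdot>\<^bsub>?P\<^esub> q"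
      by (rule poly_ract_bound[OF \<phi> cl[OF x p] q, symmetric]) (simp add: n_def)
    finally show ?thesis .
  qed
  show ?thesis
  proof (intro rmodule.intro rmodule_axioms.intro ab U.UP_ring, unfold sel)
    fix x p q assume x: "x \<in> carrier M" and p: "p \<in> carrier (UP R)" and q: "q \<in> carrier (UP R)"
    define n where "n = deg R p + deg R q + deg R (p \<oplus>\<^bsub>UP R\<^esub> q)"
    have "x \<cdot>\<^bsub>?P\<^esub> (p \<oplus>\<^bsub>UP R\<^esub> q)
        = (\<Oplus>\<^bsub>M\<^esub>i\<in>{..n}. (\<phi> ^^ i) (x \<cdot>\<^bsub>M\<^esub> coeff (UP R) (p \<oplus>\<^bsub>UP R\<^esub> q) i))"
      by (rule poly_ract_bound[OF \<phi> x]) (use p q in \<open>auto simp: n_def\<close>)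
    also have "\<dots> = (\<Oplus>\<^bsub>M\<^esub>i\<in>{..n}. (\<phi> ^^ i) (x \<cdot>\<^bsub>M\<^esub> coeff (UP R) p i)
                     \<oplus>\<^bsub>M\<^esub> (\<phi> ^^ i) (x \<cdot>\<^bsub>M\<^esub> coeff (UP R) q i))"
      by (rule M.finsum_cong') (use x p q c in \<open>auto simp: ract_r_distr ca\<close>)
    also have "\<dots> = (\<Oplus>\<^bsub>M\<^esub>i\<in>{..n}. (\<phi> ^^ i) (x \<cdot>\<^bsub>M\<^esub> coeff (UP R) p i))
                    \<oplus>\<^bsub>M\<^esub> (\<Oplus>\<^bsub>M\<^esub>i\<in>{..n}. (\<phi> ^^ i) (x \<cdot>\<^bsub>M\<^esub> coeff (UP R) q i))"
      by (rule M.finsum_addf) (use x p q c in auto)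
    also have "\<dots> = x \<cdot>\<^bsub>?P\<^esub> p \<oplus>\<^bsub>M\<^esub> x \<cdot>\<^bsub>?P\<^esub> q"
      using poly_ract_bound[OF \<phi> x p, of n] poly_ract_bound[OF \<phi> x q, of n] by (simp add: n_def)
    finally show "x \<cdot>\<^bsub>?P\<^esub> (p \<oplus>\<^bsub>UP R\<^esub> q) = x \<cdot>\<^bsub>?P\<^esub> p \<oplus>\<^bsub>M\<^esub> x \<cdot>\<^bsub>?P\<^esub> q" .
  next
    fix x y p assume x: "x \<in> carrier M" and y: "y \<in> carrier M" and p: "p \<in> carrier (UP R)"
    have "(x \<oplus>\<^bsub>M\<^esub> y) \<cdot>\<^bsub>?P\<^esub> p
        = (\<Oplus>\<^bsub>M\<^esub>i\<in>{..deg R p}. (\<phi> ^^ i) ((x \<oplus>\<^bsub>M\<^esub> y) \<cdot>\<^bsub>M\<^esub> coeff (UP R) p i))"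
      by (rule poly_ract_bound[OF \<phi>]) (use x y p in auto)
    also have "\<dots> = (\<Oplus>\<^bsub>M\<^esub>i\<in>{..deg R p}. (\<phi> ^^ i) (x \<cdot>\<^bsub>M\<^esub> coeff (UP R) p i)
                     \<oplus>\<^bsub>M\<^esub> (\<phi> ^^ i) (y \<cdot>\<^bsub>M\<^esub> coeff (UP R) p i))"
      by (rule M.finsum_cong') (use x y p c in \<open>auto simp: ract_l_distr ca\<close>)
    also have "\<dots> = (\<Oplus>\<^bsub>M\<^esub>i\<in>{..deg R p}. (\<phi> ^^ i) (x \<cdot>\<^bsub>M\<^esub> coeff (UP R) p i))
                    \<oplus>\<^bsub>M\<^esub> (\<Oplus>\<^bsub>M\<^esub>i\<in>{..deg R p}. (\<phi> ^^ i) (y \<cdot>\<^bsub>M\<^esub> coeff (UP R) p i))"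
      by (rule M.finsum_addf) (use x y p c in auto)
    finally show "(x \<oplus>\<^bsub>M\<^esub> y) \<cdot>\<^bsub>?P\<^esub> p = x \<cdot>\<^bsub>?P\<^esub> p \<oplus>\<^bsub>M\<^esub> y \<cdot>\<^bsub>?P\<^esub> p"
      using poly_ract_bound[OF \<phi> x p order_refl] poly_ract_bound[OF \<phi> y p order_refl] by simp
  next
    fix x assume x: "x \<in> carrier M"
    have "x \<cdot>\<^bsub>?P\<^esub> \<one>\<^bsub>UP R\<^esub>
        = (\<Oplus>\<^bsub>M\<^esub>i\<in>{..0}. (\<phi> ^^ i) (x \<cdot>\<^bsub>M\<^esub> coeff (UP R) \<one>\<^bsub>UP R\<^esub> i))"
      by (rule poly_ract_bound[OF \<phi> x]) auto
    then show "x \<cdot>\<^bsub>?P\<^esub> \<one>\<^bsub>UP R\<^esub> = x" using x by simp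
  qed (use cl ass in auto)
qed

lemma poly_rmod_base:
  assumes \<phi>: "\<phi> \<in> rmod_hom R M M" and x: "x \<in> carrier M"
  shows "r \<in> carrier R \<Longrightarrow> x \<cdot>\<^bsub>base_rmod R (poly_rmod R M \<phi>)\<^esub> r = x \<cdot>\<^bsub>M\<^esub> r"
    and "X_act R (poly_rmod R M \<phi>) x = \<phi> x"
proof -
  interpret U: UP_ring R "UP R" by unfold_locales
  have \<phi>x: "\<phi> x \<in> carrier M" using \<phi> x by (auto simp: rmod_hom_def)
  have c: "(\<phi> ^^ i) y \<in> carrier M" if "y \<in> carrier M" for i y
    using funpow_hom[OF \<phi>, of i] that by (auto simp: rmod_hom_def)
  have \<phi>z: "\<phi> \<zero>\<^bsub>M\<^esub> = \<zero>\<^bsub>M\<^esub>" using hom_finsum[OF \<phi>, of _ "{}"] by simp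
  show "x \<cdot>\<^bsub>base_rmod R (poly_rmod R M \<phi>)\<^esub> r = x \<cdot>\<^bsub>M\<^esub> r" if r: "r \<in> carrier R"
    using poly_ract_bound[OF \<phi> x, of "monom (UP R) r 0" 0] r x by (simp add: base_rmod_def)
  show "X_act R (poly_rmod R M \<phi>) x = \<phi> x"
    using poly_ract_bound[OF \<phi> x, of "monom (UP R) \<one>\<^bsub>R\<^esub> 1" 1] x \<phi>x
      U.deg_monom_le[of "\<one>\<^bsub>R\<^esub>" 1]
    by (simp add: X_act_def ract_zero \<phi>z Pi_def c)
qed

end

lemma poly_rmodule_eq:
  assumes R: "ring R" and V: "rmodule (UP R) V"
  shows "rmodule R (base_rmod R V)"
    and "X_act R V \<in> rmod_hom R (base_rmod R V) (base_rmod R V)"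
    and "\<lbrakk>x \<in> carrier V; p \<in> carrier (UP R)\<rbrakk>
           \<Longrightarrow> x \<cdot>\<^bsub>poly_rmod R (base_rmod R V) (X_act R V)\<^esub> p = x \<cdot>\<^bsub>V\<^esub> p"
proof -
  interpret R: ring R by (rule R)
  interpret U: UP_ring R "UP R" by unfold_locales
  interpret V: rmodule "UP R" V by (rule V)
  let ?B = "base_rmod R V"
  have sel: "carrier ?B = carrier V" "add ?B = add V" "zero ?B = zero V"
    by (simp_all add: base_rmod_def)
  have ab: "abelian_group ?B"
    by (rule abelian_groupI) (auto simp: sel V.M.a_ac intro: V.M.add.l_inv_ex)
  have mm: "monom (UP R) r 0 \<otimes>\<^bsub>UP R\<^esub> monom (UP R) s 0 = monom (UP R) (r \<otimes>\<^bsub>R\<^esub> s) 0"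
    if "r \<in> carrier R" "s \<in> carrier R" for r s
    using U.monom_mult[OF that, of 0 0] by (simp del: U.monom_mult)
  show B: "rmodule R ?B"
    by (intro rmodule.intro rmodule_axioms.intro ab R)
       (auto simp: base_rmod_def V.ract_l_distr V.ract_r_distr[symmetric] V.ract_assoc[symmetric]
          mm U.monom_one simp del: U.monom_mult)
  have com: "monom (UP R) r 0 \<otimes>\<^bsub>UP R\<^esub> monom (UP R) \<one>\<^bsub>R\<^esub> n = monom (UP R) r n"
       "monom (UP R) \<one>\<^bsub>R\<^esub> n \<otimes>\<^bsub>UP R\<^esub> monom (UP R) r 0 = monom (UP R) r n"
    if "r \<in> carrier R" for r n
    using that U.monom_mult[of r "\<one>\<^bsub>R\<^esub>" 0 n] U.monom_mult[of "\<one>\<^bsub>R\<^esub>" r n 0]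
    by (simp_all del: U.monom_mult)
  show X: "X_act R V \<in> rmod_hom R ?B ?B"
    by (auto simp: rmod_hom_def X_act_def base_rmod_def V.ract_l_distr V.ract_assoc[symmetric] com
      simp del: U.monom_mult)
  have pow: "(X_act R V ^^ i) y = y \<cdot>\<^bsub>V\<^esub> monom (UP R) \<one>\<^bsub>R\<^esub> i" if "y \<in> carrier V" for i y
  proof (induction i)
    case 0 then show ?case using that by (simp add: U.monom_one)
  next
    case (Suc i)
    then show ?case using that U.monom_mult[of "\<one>\<^bsub>R\<^esub>" "\<one>\<^bsub>R\<^esub>" i 1]
      by (simp add: X_act_def V.ract_assoc[symmetric] del: U.monom_mult)
  qed
  assume x: "x \<in> carrier V" and p: "p \<in> carrier (UP R)"
  have fs: "finsum ?B f A = finsum V f A" for f A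
    by (simp add: finsum_def finprod_def base_rmod_def)
  have "x \<cdot>\<^bsub>V\<^esub> p = x \<cdot>\<^bsub>V\<^esub> (\<Oplus>\<^bsub>UP R\<^esub>i\<in>{..deg R p}. monom (UP R) (coeff (UP R) p i) i)"
    by (simp add: U.up_repr[OF p])
  also have "\<dots> = (\<Oplus>\<^bsub>V\<^esub>i\<in>{..deg R p}. x \<cdot>\<^bsub>V\<^esub> monom (UP R) (coeff (UP R) p i) i)"
    by (rule V.ract_finsum_right[OF x]) (use p in auto)
  also have "\<dots> = (\<Oplus>\<^bsub>V\<^esub>i\<in>{..deg R p}. (X_act R V ^^ i) (x \<cdot>\<^bsub>?B\<^esub> coeff (UP R) p i))"
    by (rule V.M.finsum_cong')
       (use x p in \<open>auto simp: pow base_rmod_def V.ract_assoc[symmetric] com simp del: U.monom_mult\<close>)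
  finally show "x \<cdot>\<^bsub>poly_rmod R ?B (X_act R V)\<^esub> p = x \<cdot>\<^bsub>V\<^esub> p"
    by (simp add: poly_rmod_def fs)
qed

end

theory Submission
  imports Defs
begin

text \<open>Let \<open>T\<^sub>n F\<close> be the \<open>n\<close>-th trajectory of \<open>F\<close>. The sequence \<open>L (T\<^sub>n F)\<close> is concave, so its
  averages converge. If \<open>F' \<subseteq> F\<close> then the entropies of \<open>F\<close> and \<open>F'\<close> differ by at most
  \<open>L (F / F')\<close>; since \<open>L\<close> is upper continuous, finitely generated submodules suffice to
  compute the entropy of a locally \<open>L\<close>-finite module, even if \<open>L\<close> is not discrete.

  Let \<open>K\<close> be an invariant submodule with quotient map \<open>g\<close>. The inequality
  \<open>ent \<phi> \<ge> ent \<phi>|K + ent \<phi>/K\<close> follows by lifting finitely generated submodules of the quotient.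
  For the converse fix \<open>F\<close> and \<open>m > 0\<close> and put \<open>N = T\<^sub>m F \<inter> K\<close>. The length of
  \<open>T\<^sub>n (F + N) / T\<^sub>n N\<close> is subadditive in \<open>n\<close>, and for \<open>n = m\<close> it is \<open>L (T\<^sub>m (g F))\<close>, because
  \<open>T\<^sub>m (F + N) \<inter> K = T\<^sub>m N\<close>. Hence
  \<open>ent (\<phi>, F) \<le> ent (\<phi>, N) + L (T\<^sub>m (g F)) / m\<close>, and \<open>m\<close> tends to infinity.\<close>

section \<open>Submodules\<close>

context rmodule
begin

text \<open>Negation is the action of a scalar, so closure under the action already gives closure
  under inverses. This reduces being a submodule to zero, addition and the action.\<close>

lemma ract_minus_one:
  assumes "x \<in> carrier M"
  shows "x \<cdot>\<^bsub>M\<^esub> (\<ominus>\<^bsub>R\<^esub> \<one>\<^bsub>R\<^esub>) = \<ominus>\<^bsub>M\<^esub> x"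
proof -
  have "x \<cdot>\<^bsub>M\<^esub> (\<ominus>\<^bsub>R\<^esub> \<one>\<^bsub>R\<^esub>) \<oplus>\<^bsub>M\<^esub> x = x \<cdot>\<^bsub>M\<^esub> (\<ominus>\<^bsub>R\<^esub> \<one>\<^bsub>R\<^esub> \<oplus>\<^bsub>R\<^esub> \<one>\<^bsub>R\<^esub>)"
    using assms by (simp add: ract_r_distr)
  also have "\<dots> = \<zero>\<^bsub>M\<^esub>" using assms by (simp add: R.l_neg ract_zero)
  finally show ?thesis using assms by (simp add: M.minus_equality)
qed

lemma rsubmoduleI:
  assumes "N \<subseteq> carrier M" "\<zero>\<^bsub>M\<^esub> \<in> N"
    and "\<And>x y. x \<in> N \<Longrightarrow> y \<in> N \<Longrightarrow> x \<oplus>\<^bsub>M\<^esub> y \<in> N"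
    and r: "\<And>x r. x \<in> N \<Longrightarrow> r \<in> carrier R \<Longrightarrow> x \<cdot>\<^bsub>M\<^esub> r \<in> N"
  shows "rsubmodule R M N"
proof -
  have "\<ominus>\<^bsub>M\<^esub> x \<in> N" if "x \<in> N" for x
    using r[OF that, of "\<ominus>\<^bsub>R\<^esub> \<one>\<^bsub>R\<^esub>"] assms(1) that by (auto simp: ract_minus_one)
  then have "subgroup N (add_monoid M)"
    using assms by (intro M.add.subgroupI) (auto simp: a_inv_def)
  then show ?thesis using r by (auto simp: rsubmodule_def additive_subgroup_def)
qed

lemma rsubmoduleD:
  assumes "rsubmodule R M N"
  shows "N \<subseteq> carrier M" "\<zero>\<^bsub>M\<^esub> \<in> N" "x \<in> N \<Longrightarrow> y \<in> N \<Longrightarrow> x \<oplus>\<^bsub>M\<^esub> y \<in> N"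
    "x \<in> N \<Longrightarrow> r \<in> carrier R \<Longrightarrow> x \<cdot>\<^bsub>M\<^esub> r \<in> N" "x \<in> N \<Longrightarrow> \<ominus>\<^bsub>M\<^esub> x \<in> N"
proof -
  interpret A: additive_subgroup N M using assms by (simp add: rsubmodule_def)
  show "N \<subseteq> carrier M" "\<zero>\<^bsub>M\<^esub> \<in> N" "x \<in> N \<Longrightarrow> y \<in> N \<Longrightarrow> x \<oplus>\<^bsub>M\<^esub> y \<in> N"
    by (fact A.a_subset A.zero_closed A.a_closed)+
  show r: "x \<cdot>\<^bsub>M\<^esub> r \<in> N" if "x \<in> N" "r \<in> carrier R" for r
    using assms that by (simp add: rsubmodule_def)
  show "\<ominus>\<^bsub>M\<^esub> x \<in> N" if "x \<in> N"
    using r[OF that, of "\<ominus>\<^bsub>R\<^esub> \<one>\<^bsub>R\<^esub>"] that subsetD[OF A.a_subset] by (simp add: ract_minus_one)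
qed

text \<open>As bare closure conditions, the notion passes at once to intersections and to a smaller
  carrier with the same operations.\<close>

lemma rsubmodule_iff:
  "rsubmodule R M N \<longleftrightarrow> N \<subseteq> carrier M \<and> \<zero>\<^bsub>M\<^esub> \<in> N \<and> (\<forall>x\<in>N. \<forall>y\<in>N. x \<oplus>\<^bsub>M\<^esub> y \<in> N) \<and>
     (\<forall>x\<in>N. \<forall>r\<in>carrier R. x \<cdot>\<^bsub>M\<^esub> r \<in> N)"
  using rsubmoduleI[of N] rsubmoduleD[of N] by blast

lemma rsubmodule_carrier: "rsubmodule R M (carrier M)"
  by (rule rsubmoduleI) auto

lemma zero_ract: "r \<in> carrier R \<Longrightarrow> \<zero>\<^bsub>M\<^esub> \<cdot>\<^bsub>M\<^esub> r = \<zero>\<^bsub>M\<^esub>"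
  using ract_finsum_left[of r _ "{}"] by simp

lemma rsubmodule_zero: "rsubmodule R M {\<zero>\<^bsub>M\<^esub>}"
  by (rule rsubmoduleI) (auto simp: zero_ract)

lemma rsubmodule_Int: "rsubmodule R M A \<Longrightarrow> rsubmodule R M B \<Longrightarrow> rsubmodule R M (A \<inter> B)"
  unfolding rsubmodule_iff by blast

lemma rsubmodule_rmodule:
  assumes N: "rsubmodule R M N"
  shows "rmodule R (M\<lparr>carrier := N\<rparr>)"
proof -
  note D = rsubmoduleD[OF N]
  have c: "x \<in> carrier M" if "x \<in> N" for x using D that by blast
  have "abelian_group (M\<lparr>carrier := N\<rparr>)"
  proof (rule abelian_groupI)
    fix x assume "x \<in> carrier (M\<lparr>carrier := N\<rparr>)"
    then show "\<exists>y\<in>carrier (M\<lparr>carrier := N\<rparr>). y \<oplus>\<^bsub>M\<lparr>carrier := N\<rparr>\<^esub> x = \<zero>\<^bsub>M\<lparr>carrier := N\<rparr>\<^esub>"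
      by (intro bexI[of _ "\<ominus>\<^bsub>M\<^esub> x"]) (auto simp: D c M.l_neg)
  qed (auto simp: D c M.a_ac)
  then show ?thesis
    by (intro rmodule.intro ring_axioms rmodule_axioms.intro)
       (auto simp: D c ract_l_distr ract_r_distr ract_assoc)
qed

lemma rsubmodule_sub_iff:
  assumes N: "rsubmodule R M N"
  shows "rsubmodule R (M\<lparr>carrier := N\<rparr>) A \<longleftrightarrow> rsubmodule R M A \<and> A \<subseteq> N"
  using rsubmoduleD(1)[OF N]
  unfolding rmodule.rsubmodule_iff[OF rsubmodule_rmodule[OF N]] rsubmodule_iff by auto

text \<open>\<open>hull\<close> intersects all submodules containing \<open>A\<close>. The carrier
  is one of them because \<open>A\<close> lies in it, and this keeps the intersection inside
  \<open>M\<close>.\<close>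

lemma rsubmodule_hull:
  assumes "A \<subseteq> carrier M"
  shows "rsubmodule R M (rsubmodule R M hull A)"
proof -
  have "rsubmodule R M hull A \<subseteq> carrier M"
    using hull_minimal[of A _ "rsubmodule R M", OF assms rsubmodule_carrier] .
  then show ?thesis unfolding hull_def by (intro rsubmoduleI) (auto simp: rsubmodule_iff)
qed

lemma fg_rsubmodule: "fg_submodule R M F \<Longrightarrow> rsubmodule R M F"
  by (auto simp: fg_submodule_def rsubmodule_hull)

lemma fg_submodule_zero: "fg_submodule R M {\<zero>\<^bsub>M\<^esub>}"
proof -
  have "{\<zero>\<^bsub>M\<^esub>} = rsubmodule R M hull {}"
  proof (rule hull_unique[symmetric])
    show "rsubmodule R M {\<zero>\<^bsub>M\<^esub>}" by (rule rsubmodule_zero)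
  qed (simp_all add: rsubmoduleD(2))
  then show ?thesis unfolding fg_submodule_def by blast
qed

text \<open>Each hull is a submodule in the sense that defines the other one, so minimality applies
  in both directions.\<close>

lemma hull_sub:
  assumes N: "rsubmodule R M N" and A: "A \<subseteq> N"
  shows "rsubmodule R (M\<lparr>carrier := N\<rparr>) hull A = rsubmodule R M hull A"
proof (rule antisym)
  have c: "A \<subseteq> carrier M" using A rsubmoduleD(1)[OF N] by blast
  have "rsubmodule R M hull A \<subseteq> N" using hull_minimal[of A N "rsubmodule R M"] A N by blast
  then show "rsubmodule R (M\<lparr>carrier := N\<rparr>) hull A \<subseteq> rsubmodule R M hull A"
    using rsubmodule_hull[OF c]
    by (intro hull_minimal hull_subset) (simp add: rsubmodule_sub_iff[OF N])
  interpret S: rmodule R "M\<lparr>carrier := N\<rparr>" by (rule rsubmodule_rmodule[OF N])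
  show "rsubmodule R M hull A \<subseteq> rsubmodule R (M\<lparr>carrier := N\<rparr>) hull A"
    using S.rsubmodule_hull[of A] A
    by (intro hull_minimal hull_subset) (simp add: rsubmodule_sub_iff[OF N])
qed

text \<open>Lets upper continuity on a submodule be evaluated with finitely generated submodules of
  the ambient module.\<close>

lemma fg_submodule_sub_iff:
  assumes N: "rsubmodule R M N"
  shows "fg_submodule R (M\<lparr>carrier := N\<rparr>) F \<longleftrightarrow> fg_submodule R M F \<and> F \<subseteq> N"
proof
  assume "fg_submodule R (M\<lparr>carrier := N\<rparr>) F"
  then obtain A where A: "finite A" "A \<subseteq> N" "F = rsubmodule R (M\<lparr>carrier := N\<rparr>) hull A"
    by (auto simp: fg_submodule_def)
  then have F: "F = rsubmodule R M hull A" using hull_sub[OF N] by simp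
  then have "F \<subseteq> N" using hull_minimal[of A N "rsubmodule R M"] A(2) N by blast
  moreover have "A \<subseteq> carrier M" using A(2) rsubmoduleD(1)[OF N] by blast
  ultimately show "fg_submodule R M F \<and> F \<subseteq> N" using A(1) F by (auto simp: fg_submodule_def)
next
  assume *: "fg_submodule R M F \<and> F \<subseteq> N"
  then obtain A where A: "finite A" "F = rsubmodule R M hull A"
    by (auto simp: fg_submodule_def)
  then have "A \<subseteq> N" using * hull_subset[of A "rsubmodule R M"] by blast
  then show "fg_submodule R (M\<lparr>carrier := N\<rparr>) F"
    using A hull_sub[OF N] by (auto simp: fg_submodule_def)
qed

lemma set_add_memI: "a \<in> A \<Longrightarrow> b \<in> B \<Longrightarrow> a \<oplus>\<^bsub>M\<^esub> b \<in> A <+>\<^bsub>M\<^esub> B"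
  by (auto simp: set_add_defs)

lemma set_add_memE:
  assumes "x \<in> A <+>\<^bsub>M\<^esub> B" obtains a b where "a \<in> A" "b \<in> B" "x = a \<oplus>\<^bsub>M\<^esub> b"
  using assms by (auto simp: set_add_defs)

lemma rsubmodule_set_add:
  assumes A: "rsubmodule R M A" and B: "rsubmodule R M B"
  shows "rsubmodule R M (A <+>\<^bsub>M\<^esub> B)"
proof (rule rsubmoduleI)
  note DA = rsubmoduleD[OF A] and DB = rsubmoduleD[OF B]
  have c: "x \<in> A \<Longrightarrow> x \<in> carrier M" "x \<in> B \<Longrightarrow> x \<in> carrier M" for x using DA(1) DB(1) by auto
  show "A <+>\<^bsub>M\<^esub> B \<subseteq> carrier M" by (auto elim!: set_add_memE intro: c)
  show "\<zero>\<^bsub>M\<^esub> \<in> A <+>\<^bsub>M\<^esub> B" using set_add_memI[OF DA(2) DB(2)] by simp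
next
  note DA = rsubmoduleD[OF A] and DB = rsubmoduleD[OF B]
  have c: "x \<in> A \<Longrightarrow> x \<in> carrier M" "x \<in> B \<Longrightarrow> x \<in> carrier M" for x using DA(1) DB(1) by auto
  fix x assume "x \<in> A <+>\<^bsub>M\<^esub> B"
  then obtain a b where x: "a \<in> A" "b \<in> B" "x = a \<oplus>\<^bsub>M\<^esub> b" by (rule set_add_memE)
  show "x \<oplus>\<^bsub>M\<^esub> y \<in> A <+>\<^bsub>M\<^esub> B" if y_in: "y \<in> A <+>\<^bsub>M\<^esub> B" for y
  proof -
    obtain a' b' where y: "a' \<in> A" "b' \<in> B" "y = a' \<oplus>\<^bsub>M\<^esub> b'" using y_in by (rule set_add_memE)
    have "x \<oplus>\<^bsub>M\<^esub> y = (a \<oplus>\<^bsub>M\<^esub> a') \<oplus>\<^bsub>M\<^esub> (b \<oplus>\<^bsub>M\<^esub> b')"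
      using x y by (simp add: c M.a_ac)
    then show ?thesis using set_add_memI[OF DA(3)[OF x(1) y(1)] DB(3)[OF x(2) y(2)]] by simp
  qed
  show "x \<cdot>\<^bsub>M\<^esub> r \<in> A <+>\<^bsub>M\<^esub> B" if r: "r \<in> carrier R" for r
  proof -
    have "x \<cdot>\<^bsub>M\<^esub> r = a \<cdot>\<^bsub>M\<^esub> r \<oplus>\<^bsub>M\<^esub> b \<cdot>\<^bsub>M\<^esub> r" using x r by (simp add: c ract_l_distr)
    then show ?thesis using set_add_memI[OF DA(4)[OF x(1) r] DB(4)[OF x(2) r]] by simp
  qed
qed

lemma set_add_upper:
  assumes A: "rsubmodule R M A" and B: "rsubmodule R M B"
  shows "A \<subseteq> A <+>\<^bsub>M\<^esub> B" "B \<subseteq> A <+>\<^bsub>M\<^esub> B"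
proof -
  show "A \<subseteq> A <+>\<^bsub>M\<^esub> B"
  proof
    fix x assume "x \<in> A"
    then have "x = x \<oplus>\<^bsub>M\<^esub> \<zero>\<^bsub>M\<^esub>" using rsubmoduleD(1)[OF A] by auto
    then show "x \<in> A <+>\<^bsub>M\<^esub> B" using set_add_memI \<open>x \<in> A\<close> rsubmoduleD(2)[OF B] by metis
  qed
  show "B \<subseteq> A <+>\<^bsub>M\<^esub> B"
  proof
    fix x assume "x \<in> B"
    then have "x = \<zero>\<^bsub>M\<^esub> \<oplus>\<^bsub>M\<^esub> x" using rsubmoduleD(1)[OF B] by auto
    then show "x \<in> A <+>\<^bsub>M\<^esub> B" using set_add_memI \<open>x \<in> B\<close> rsubmoduleD(2)[OF A] by metis
  qed
qed

lemma set_add_least: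
  assumes "rsubmodule R M C" "A \<subseteq> C" "B \<subseteq> C"
  shows "A <+>\<^bsub>M\<^esub> B \<subseteq> C"
  using assms rsubmoduleD(3)[OF assms(1)] by (auto elim!: set_add_memE)

end

section \<open>Homomorphisms, kernels and images\<close>

lemma rmod_homD:
  assumes "h \<in> rmod_hom R M N"
  shows "x \<in> carrier M \<Longrightarrow> h x \<in> carrier N"
    "x \<in> carrier M \<Longrightarrow> y \<in> carrier M \<Longrightarrow> h (x \<oplus>\<^bsub>M\<^esub> y) = h x \<oplus>\<^bsub>N\<^esub> h y"
    "x \<in> carrier M \<Longrightarrow> r \<in> carrier R \<Longrightarrow> h (x \<cdot>\<^bsub>M\<^esub> r) = h x \<cdot>\<^bsub>N\<^esub> r"
  using assms by (auto simp: rmod_hom_def)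

locale rmodule_hom = rmodule R M + N: rmodule R N
  for R (structure) and M :: "('r, 'm) rmod" and N :: "('r, 'n) rmod" +
  fixes h assumes hom: "h \<in> rmod_hom R M N"
begin

lemmas homD = rmod_homD[OF hom]

lemma hom_zero: "h \<zero>\<^bsub>M\<^esub> = \<zero>\<^bsub>N\<^esub>"
proof -
  have "h \<zero>\<^bsub>M\<^esub> \<oplus>\<^bsub>N\<^esub> h \<zero>\<^bsub>M\<^esub> = h \<zero>\<^bsub>M\<^esub>" by (simp flip: homD)
  then show ?thesis by (simp add: homD)
qed

definition kernel where "kernel = {x \<in> carrier M. h x = \<zero>\<^bsub>N\<^esub>}"

lemma rsubmodule_vimage:
  assumes "rsubmodule R N B" shows "rsubmodule R M {x \<in> carrier M. h x \<in> B}"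
  by (rule rsubmoduleI) (auto simp: homD hom_zero N.rsubmoduleD[OF assms])

lemma rsubmodule_kernel: "rsubmodule R M kernel"
  using rsubmodule_vimage[OF N.rsubmodule_zero] by (simp add: kernel_def)

lemma rsubmodule_image:
  assumes A: "rsubmodule R M A" shows "rsubmodule R N (h ` A)"
proof -
  note D = rsubmoduleD[OF A]
  have c: "x \<in> carrier M" if "x \<in> A" for x using D that by blast
  show ?thesis
  proof (rule N.rsubmoduleI)
    show "\<zero>\<^bsub>N\<^esub> \<in> h ` A" using D(2) hom_zero by (metis imageI)
    fix x assume "x \<in> h ` A"
    then obtain a where a: "a \<in> A" "x = h a" by auto
    show "x \<oplus>\<^bsub>N\<^esub> y \<in> h ` A" if y: "y \<in> h ` A" for y
    proof -
      obtain b where "b \<in> A" "y = h b" using y by auto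
      then have "x \<oplus>\<^bsub>N\<^esub> y = h (a \<oplus>\<^bsub>M\<^esub> b)" using a by (simp add: c homD)
      then show ?thesis using D a \<open>b \<in> A\<close> by blast
    qed
    show "x \<cdot>\<^bsub>N\<^esub> r \<in> h ` A" if "r \<in> carrier R" for r
    proof -
      have "x \<cdot>\<^bsub>N\<^esub> r = h (a \<cdot>\<^bsub>M\<^esub> r)" using a that by (simp add: c homD)
      then show ?thesis using D a that by blast
    qed
  qed (use homD c in auto)
qed

text \<open>One inclusion comes from preimages of submodules being submodules, the other from images
  being submodules.\<close>

lemma image_hull:
  assumes A: "A \<subseteq> carrier M"
  shows "h ` (rsubmodule R M hull A) = rsubmodule R N hull (h ` A)"
proof (rule antisym)
  have hA: "h ` A \<subseteq> carrier N" using A homD by auto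
  have "rsubmodule R M hull A \<subseteq> {x \<in> carrier M. h x \<in> rsubmodule R N hull (h ` A)}"
    by (intro hull_minimal rsubmodule_vimage N.rsubmodule_hull[OF hA])
       (use A in \<open>auto intro: hull_inc\<close>)
  then show "h ` (rsubmodule R M hull A) \<subseteq> rsubmodule R N hull (h ` A)" by auto
  show "rsubmodule R N hull (h ` A) \<subseteq> h ` (rsubmodule R M hull A)"
    by (intro hull_minimal rsubmodule_image rsubmodule_hull A image_mono hull_subset)
qed

lemma fg_submodule_image: "fg_submodule R M F \<Longrightarrow> fg_submodule R N (h ` F)"
  using homD unfolding fg_submodule_def by (smt (verit) finite_imageI image_hull image_subset_iff subsetD)

text \<open>Preimages of the finitely many generators generate the lift. In a locally finite module
  such a lift has finite length, which is why the lower bound for the entropy works with finitely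
  generated submodules of the quotient.\<close>

lemma fg_submodule_lift:
  assumes "h ` carrier M = carrier N" "fg_submodule R N F"
  obtains F' where "fg_submodule R M F'" "h ` F' = F"
proof -
  obtain A where A: "finite A" "A \<subseteq> carrier N" "F = rsubmodule R N hull A"
    using assms(2) by (auto simp: fg_submodule_def)
  then obtain B where B: "B \<subseteq> carrier M" "finite B" "A = h ` B"
    using assms(1) finite_subset_image by metis
  then have "fg_submodule R M (rsubmodule R M hull B)" by (auto simp: fg_submodule_def)
  then show thesis using that image_hull[OF B(1)] A B by metis
qed

lemma image_set_add:
  assumes "A \<subseteq> carrier M" "B \<subseteq> carrier M"
  shows "h ` (A <+>\<^bsub>M\<^esub> B) = h ` A <+>\<^bsub>N\<^esub> h ` B"
proof -
  have "h (a \<oplus>\<^bsub>M\<^esub> b) = h a \<oplus>\<^bsub>N\<^esub> h b" if "a \<in> A" "b \<in> B" for a b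
    using that assms homD by blast
  then show ?thesis by (force simp: set_add_defs)
qed

end

section \<open>Trajectories\<close>

context rmodule
begin

lemma rmodule_hom_endo: "\<phi> \<in> rmod_hom R M M \<Longrightarrow> rmodule_hom R M M \<phi>"
  by (intro rmodule_hom.intro rmodule_hom_axioms.intro rmodule_axioms)

lemma funpow_image_sub:
  assumes "\<phi> \<in> rmod_hom R M M" "rsubmodule R M F"
  shows "rsubmodule R M ((\<phi> ^^ n) ` F)"
  by (rule rmodule_hom.rsubmodule_image[OF rmodule_hom_endo[OF funpow_hom]]) (use assms in auto)

lemma trajectory_0: "trajectory M \<phi> F 0 = {\<zero>\<^bsub>M\<^esub>}"
  by (simp add: trajectory_def)

text \<open>Replaces sums over families by a recursion, on which the inductions over trajectories
  rest.\<close>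

lemma trajectory_Suc:
  assumes \<phi>: "\<phi> \<in> rmod_hom R M M" and F: "F \<subseteq> carrier M"
  shows "trajectory M \<phi> F (Suc n) = trajectory M \<phi> F n <+>\<^bsub>M\<^esub> (\<phi> ^^ n) ` F"
proof -
  have c: "y \<in> carrier M" if "y \<in> (\<phi> ^^ i) ` F" for y i
    using that F rmod_homD(1)[OF funpow_hom[OF \<phi>]] by blast
  have sum: "(\<Oplus>\<^bsub>M\<^esub>i\<in>{..<Suc n}. x i) = (\<Oplus>\<^bsub>M\<^esub>i\<in>{..<n}. x i) \<oplus>\<^bsub>M\<^esub> x n"
    if "\<forall>i<Suc n. x i \<in> (\<phi> ^^ i) ` F" for x
  proof -
    have "x i \<in> carrier M" if "i < Suc n" for i using \<open>\<forall>i<Suc n. x i \<in> (\<phi> ^^ i) ` F\<close> c that by blast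
    then have "x \<in> {..<n} \<rightarrow> carrier M" "x n \<in> carrier M" by auto
    then show ?thesis by (simp add: lessThan_Suc M.finsum_insert M.a_comm)
  qed
  show ?thesis
  proof (intro antisym subsetI)
    fix z assume "z \<in> trajectory M \<phi> F (Suc n)"
    then obtain x where x: "\<forall>i<Suc n. x i \<in> (\<phi> ^^ i) ` F" "z = (\<Oplus>\<^bsub>M\<^esub>i\<in>{..<Suc n}. x i)"
      by (auto simp: trajectory_def)
    have "(\<Oplus>\<^bsub>M\<^esub>i\<in>{..<n}. x i) \<in> trajectory M \<phi> F n" using x(1) by (auto simp: trajectory_def)
    then show "z \<in> trajectory M \<phi> F n <+>\<^bsub>M\<^esub> (\<phi> ^^ n) ` F"
      unfolding x(2) sum[OF x(1)] using x(1) by (intro set_add_memI) auto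
  next
    fix z assume "z \<in> trajectory M \<phi> F n <+>\<^bsub>M\<^esub> (\<phi> ^^ n) ` F"
    then obtain x y where x: "\<forall>i<n. x i \<in> (\<phi> ^^ i) ` F" and y: "y \<in> (\<phi> ^^ n) ` F"
      and z: "z = (\<Oplus>\<^bsub>M\<^esub>i\<in>{..<n}. x i) \<oplus>\<^bsub>M\<^esub> y"
      by (auto simp: trajectory_def elim!: set_add_memE)
    define x' where "x' = x(n := y)"
    have x': "\<forall>i<Suc n. x' i \<in> (\<phi> ^^ i) ` F" using x y by (auto simp: x'_def less_Suc_eq)
    have "(\<Oplus>\<^bsub>M\<^esub>i\<in>{..<n}. x i) = (\<Oplus>\<^bsub>M\<^esub>i\<in>{..<n}. x' i)"
    proof (rule M.finsum_cong'[OF refl])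
      show "x' \<in> {..<n} \<rightarrow> carrier M" using x' c by (meson Pi_I lessThan_iff less_SucI)
    qed (simp add: x'_def)
    then have "z = (\<Oplus>\<^bsub>M\<^esub>i\<in>{..<Suc n}. x' i)" using z sum[OF x'] by (simp add: x'_def)
    then show "z \<in> trajectory M \<phi> F (Suc n)" using x' by (auto simp: trajectory_def)
  qed
qed

lemma rsubmodule_trajectory:
  assumes \<phi>: "\<phi> \<in> rmod_hom R M M" and F: "rsubmodule R M F"
  shows "rsubmodule R M (trajectory M \<phi> F n)"
  by (induction n)
     (use assms in \<open>simp_all add: trajectory_0 rsubmodule_zero trajectory_Suc[OF \<phi> rsubmoduleD(1)[OF F]]
        rsubmodule_set_add funpow_image_sub\<close>)

lemma funpow_image_trajectory:
  assumes \<phi>: "\<phi> \<in> rmod_hom R M M" and F: "rsubmodule R M F" and "i < n"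
  shows "(\<phi> ^^ i) ` F \<subseteq> trajectory M \<phi> F n"
  using \<open>i < n\<close>
proof (induction n)
  case (Suc n)
  note upper = set_add_upper[OF rsubmodule_trajectory[OF \<phi> F, of n] funpow_image_sub[OF \<phi> F, of n]]
  show ?case
    using Suc upper unfolding trajectory_Suc[OF \<phi> rsubmoduleD(1)[OF F]] less_Suc_eq by blast
qed simp

text \<open>Together with \<open>funpow_image_trajectory\<close> this makes the trajectory the least
  submodule containing the first \<open>n\<close> images, so inclusions can be checked one image at
  a time.\<close>

lemma trajectory_least:
  assumes \<phi>: "\<phi> \<in> rmod_hom R M M" and F: "F \<subseteq> carrier M" and C: "rsubmodule R M C"
    and "\<And>i. i < n \<Longrightarrow> (\<phi> ^^ i) ` F \<subseteq> C"
  shows "trajectory M \<phi> F n \<subseteq> C"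
  using assms(4)
proof (induction n)
  case 0
  then show ?case using rsubmoduleD(2)[OF C] by (simp add: trajectory_0)
next
  case (Suc n)
  then show ?case by (simp add: trajectory_Suc[OF \<phi> F] set_add_least[OF C])
qed

lemma trajectory_mono:
  assumes \<phi>: "\<phi> \<in> rmod_hom R M M" and F: "rsubmodule R M F" and "F' \<subseteq> F"
  shows "trajectory M \<phi> F' n \<subseteq> trajectory M \<phi> F n"
proof (rule trajectory_least[OF \<phi> _ rsubmodule_trajectory[OF \<phi> F]])
  show "F' \<subseteq> carrier M" using rsubmoduleD(1)[OF F] assms(3) by blast
  show "(\<phi> ^^ i) ` F' \<subseteq> trajectory M \<phi> F n" if "i < n" for i
    using funpow_image_trajectory[OF \<phi> F that] assms(3) by blast
qed

text \<open>The images with exponent at least \<open>n\<close> are \<open>\<phi> ^^ n\<close>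
  applied to earlier ones. Splitting off one step gives concavity of the lengths; splitting into
  blocks gives the upper bound for the entropy of an extension.\<close>

lemma trajectory_add:
  assumes \<phi>: "\<phi> \<in> rmod_hom R M M" and F: "rsubmodule R M F"
  shows "trajectory M \<phi> F (n + k) = trajectory M \<phi> F n <+>\<^bsub>M\<^esub> (\<phi> ^^ n) ` trajectory M \<phi> F k"
    (is "?L = ?R")
proof (rule antisym)
  note T = rsubmodule_trajectory[OF \<phi> F]
  note Fc = rsubmoduleD(1)[OF F]
  have S: "rsubmodule R M ?R" by (intro rsubmodule_set_add T funpow_image_sub[OF \<phi>])
  note upper = set_add_upper[OF T[of n] funpow_image_sub[OF \<phi> T[of k], of n]]
  show "?L \<subseteq> ?R"
  proof (rule trajectory_least[OF \<phi> Fc S])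
    fix i assume "i < n + k"
    show "(\<phi> ^^ i) ` F \<subseteq> ?R"
    proof (cases "i < n")
      case True
      then show ?thesis using funpow_image_trajectory[OF \<phi> F True] upper(1) by blast
    next
      case False
      then have "(\<phi> ^^ i) ` F = (\<phi> ^^ n) ` (\<phi> ^^ (i - n)) ` F"
        using funpow_add[of n "i - n" \<phi>] by (simp add: image_comp)
      also have "\<dots> \<subseteq> (\<phi> ^^ n) ` trajectory M \<phi> F k"
        by (intro image_mono funpow_image_trajectory[OF \<phi> F]) (use False \<open>i < n + k\<close> in auto)
      finally show ?thesis using upper(2) by blast
    qed
  qed
  interpret P: rmodule_hom R M M "\<phi> ^^ n" by (rule rmodule_hom_endo[OF funpow_hom[OF \<phi>]])
  show "?R \<subseteq> ?L"
  proof (rule set_add_least[OF T])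
    show "trajectory M \<phi> F n \<subseteq> ?L"
      by (rule trajectory_least[OF \<phi> Fc T]) (use funpow_image_trajectory[OF \<phi> F] in auto)
    \<comment> \<open>The inclusion of an image is restated with a preimage, which is a submodule,
      so that minimality of the trajectory applies.\<close>
    have "trajectory M \<phi> F k \<subseteq> {x \<in> carrier M. (\<phi> ^^ n) x \<in> ?L}"
    proof (rule trajectory_least[OF \<phi> Fc P.rsubmodule_vimage[OF T]])
      fix i assume "i < k"
      then have "(\<phi> ^^ (n + i)) ` F \<subseteq> ?L" by (intro funpow_image_trajectory[OF \<phi> F]) auto
      then have "(\<phi> ^^ n) ` (\<phi> ^^ i) ` F \<subseteq> ?L" unfolding funpow_add image_comp .
      then show "(\<phi> ^^ i) ` F \<subseteq> {x \<in> carrier M. (\<phi> ^^ n) x \<in> ?L}"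
        using rsubmoduleD(1)[OF funpow_image_sub[OF \<phi> F, of i]] by blast
    qed
    then show "(\<phi> ^^ n) ` trajectory M \<phi> F k \<subseteq> ?L" by blast
  qed
qed

lemma trajectory_1:
  assumes \<phi>: "\<phi> \<in> rmod_hom R M M" and F: "rsubmodule R M F"
  shows "trajectory M \<phi> F 1 = F"
proof (rule antisym)
  show "trajectory M \<phi> F 1 \<subseteq> F"
    by (rule trajectory_least[OF \<phi> rsubmoduleD(1)[OF F] F]) auto
  show "F \<subseteq> trajectory M \<phi> F 1" using funpow_image_trajectory[OF \<phi> F, of 0 1] by simp
qed

end

lemma (in rmodule_hom) funpow_intertwine:
  assumes \<phi>: "\<phi> \<in> rmod_hom R M M"
    and "\<And>x. x \<in> carrier M \<Longrightarrow> h (\<phi> x) = \<psi> (h x)" and "x \<in> carrier M"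
  shows "h ((\<phi> ^^ n) x) = (\<psi> ^^ n) (h x)"
  by (induction n) (use assms rmod_homD(1)[OF funpow_hom[OF \<phi>]] in auto)

lemma (in rmodule_hom) image_trajectory:
  assumes \<phi>: "\<phi> \<in> rmod_hom R M M" and \<psi>: "\<psi> \<in> rmod_hom R N N"
    and com: "\<And>x. x \<in> carrier M \<Longrightarrow> h (\<phi> x) = \<psi> (h x)" and F: "rsubmodule R M F"
  shows "h ` trajectory M \<phi> F n = trajectory N \<psi> (h ` F) n"
proof (induction n)
  case 0
  then show ?case by (simp add: trajectory_0 N.trajectory_0 hom_zero)
next
  case (Suc n)
  note c = rsubmoduleD(1)[OF F] rsubmoduleD(1)[OF rsubmodule_trajectory[OF \<phi> F, of n]]
    rsubmoduleD(1)[OF funpow_image_sub[OF \<phi> F, of n]]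
  have "h ` (\<phi> ^^ n) ` F = (\<psi> ^^ n) ` h ` F"
    unfolding image_image using c(1)
    by (intro image_cong refl funpow_intertwine[OF \<phi> com]) auto
  then show ?case
    using Suc c N.rsubmoduleD(1)[OF rsubmodule_image[OF F]]
    by (simp add: trajectory_Suc[OF \<phi>] N.trajectory_Suc[OF \<psi>] image_set_add)
qed

section \<open>Length\<close>

lemma length_functionD:
  assumes "length_function S C L"
  shows "M \<in> C \<Longrightarrow> carrier M = {\<zero>\<^bsub>M\<^esub>} \<Longrightarrow> L M = 0"
    and "M' \<in> C \<Longrightarrow> M \<in> C \<Longrightarrow> M'' \<in> C \<Longrightarrow> short_exact S M' M M'' f g \<Longrightarrow> L M = L M' + L M''"
    and "M \<in> C \<Longrightarrow> L M = (SUP F\<in>{F. fg_submodule S M F}. L (M\<lparr>carrier := F\<rparr>))"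
proof -
  note D = assms[unfolded length_function_def]
  show "M \<in> C \<Longrightarrow> carrier M = {\<zero>\<^bsub>M\<^esub>} \<Longrightarrow> L M = 0" using D by meson
  show "M' \<in> C \<Longrightarrow> M \<in> C \<Longrightarrow> M'' \<in> C \<Longrightarrow> short_exact S M' M M'' f g \<Longrightarrow> L M = L M' + L M''"
    using D by meson
  show "M \<in> C \<Longrightarrow> L M = (SUP F\<in>{F. fg_submodule S M F}. L (M\<lparr>carrier := F\<rparr>))" using D by meson
qed

locale length_rmodule = rmodule R M for R (structure) and M :: "('r, 'm) rmod" +
  fixes L :: "('r, 'm) rmod \<Rightarrow> ennreal"
  assumes length_function: "length_function R (Right_Mod R) L"
begin

abbreviation len :: "'m set \<Rightarrow> ennreal" where "len A \<equiv> L (M\<lparr>carrier := A\<rparr>)"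

lemma length_rmodule_other: "rmodule R N \<Longrightarrow> length_rmodule R N L"
  by (intro length_rmodule.intro length_rmodule_axioms.intro length_function)

lemma len_zero: "len {\<zero>\<^bsub>M\<^esub>} = 0"
  by (rule length_functionD(1)[OF length_function])
     (simp_all add: Right_Mod_def rsubmodule_rmodule rsubmodule_zero)

lemma len_image:
  assumes "rmodule_hom R M N h" and A: "rsubmodule R M A"
  shows "len A = len (A \<inter> {x \<in> carrier M. h x = \<zero>\<^bsub>N\<^esub>}) + L (N\<lparr>carrier := h ` A\<rparr>)"
proof -
  interpret h: rmodule_hom R M N h by (rule assms(1))
  let ?K = "A \<inter> {x \<in> carrier M. h x = \<zero>\<^bsub>N\<^esub>}"
  have K: "rsubmodule R M ?K"
    using rsubmodule_Int[OF A h.rsubmodule_kernel] by (simp add: h.kernel_def)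
  have c: "x \<in> carrier M" if "x \<in> A" for x using that rsubmoduleD(1)[OF A] by blast
  have "h (x \<oplus>\<^bsub>M\<^esub> y) = h x \<oplus>\<^bsub>N\<^esub> h y" "h (x \<cdot>\<^bsub>M\<^esub> r) = h x \<cdot>\<^bsub>N\<^esub> r"
    if "x \<in> A" "y \<in> A" "r \<in> carrier R" for x y r
    using that by (simp_all add: c h.homD)
  then have "short_exact R (M\<lparr>carrier := ?K\<rparr>) (M\<lparr>carrier := A\<rparr>) (N\<lparr>carrier := h ` A\<rparr>) id h"
    unfolding short_exact_def rmod_hom_def using c by (intro conjI CollectI) auto
  then show ?thesis
    by (rule length_functionD(2)[OF length_function, rotated 3])
       (simp_all add: Right_Mod_def rsubmodule_rmodule K A h.N.rsubmodule_rmodule h.rsubmodule_image)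
qed

lemma len_quot:
  assumes N: "rsubmodule R M N" and A: "rsubmodule R M A"
  shows "len A = len (A \<inter> N) + L (quot_rmod M N\<lparr>carrier := coset_rep M N ` A\<rparr>)"
proof -
  have "rmodule_hom R M (quot_rmod M N) (coset_rep M N)"
    by (intro rmodule_hom.intro rmodule_hom_axioms.intro rmodule_axioms quot_rmod_is_rmodule
        quot_rmod_is_quotient N)
  from len_image[OF this A] show ?thesis unfolding quot_rmod_is_quotient(3)[OF N] .
qed

lemma len_mono:
  assumes "rsubmodule R M A" "rsubmodule R M B" "A \<subseteq> B"
  shows "len A \<le> len B"
  using len_quot[OF assms(1,2)] assms(3) by (simp add: Int_absorb1)

text \<open>The second isomorphism theorem: \<open>A + B\<close> and \<open>B\<close> have the same
  image modulo \<open>A\<close>. Written with sums only, since lengths may be infinite.\<close>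

lemma len_modular:
  assumes A: "rsubmodule R M A" and B: "rsubmodule R M B"
  shows "len (A <+>\<^bsub>M\<^esub> B) + len (A \<inter> B) = len A + len B"
proof -
  have c: "B \<subseteq> carrier M" by (rule rsubmoduleD(1)[OF B])
  have "coset_rep M A ` (A <+>\<^bsub>M\<^esub> B) = coset_rep M A ` B"
  proof
    show "coset_rep M A ` (A <+>\<^bsub>M\<^esub> B) \<subseteq> coset_rep M A ` B"
      using coset_rep_shift[OF A] c by (auto elim!: set_add_memE)
    show "coset_rep M A ` B \<subseteq> coset_rep M A ` (A <+>\<^bsub>M\<^esub> B)"
      by (intro image_mono set_add_upper A B)
  qed
  then show ?thesis
    using len_quot[OF A rsubmodule_set_add[OF A B]] len_quot[OF A B] set_add_upper(1)[OF A B]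
    by (simp add: Int_absorb2 Int_commute ac_simps)
qed

lemma len_add_le:
  assumes "rsubmodule R M A" "rsubmodule R M B"
  shows "len (A <+>\<^bsub>M\<^esub> B) \<le> len A + len B"
  using len_modular[OF assms] by (metis le_iff_add)

text \<open>Adding \<open>C\<close> enlarges the bigger module \<open>A\<close> by at most as much
  as it enlarges \<open>B\<close>. This is modularity for \<open>B + C\<close> and \<open>A\<close>:
  their sum contains \<open>A + C\<close> and their intersection contains \<open>B\<close>.\<close>

lemma len_exchange:
  assumes A: "rsubmodule R M A" and B: "rsubmodule R M B" and C: "rsubmodule R M C" and "B \<subseteq> A"
  shows "len (A <+>\<^bsub>M\<^esub> C) + len B \<le> len (B <+>\<^bsub>M\<^esub> C) + len A"
proof -
  note BC = rsubmodule_set_add[OF B C]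
  note u = set_add_upper[OF B C] set_add_upper[OF BC A]
  have "len (A <+>\<^bsub>M\<^esub> C) + len B \<le> len ((B <+>\<^bsub>M\<^esub> C) <+>\<^bsub>M\<^esub> A) + len ((B <+>\<^bsub>M\<^esub> C) \<inter> A)"
  proof (intro add_mono len_mono A B C BC rsubmodule_set_add rsubmodule_Int)
    show "A <+>\<^bsub>M\<^esub> C \<subseteq> (B <+>\<^bsub>M\<^esub> C) <+>\<^bsub>M\<^esub> A"
      using u by (intro set_add_least rsubmodule_set_add A B C) auto
    show "B \<subseteq> (B <+>\<^bsub>M\<^esub> C) \<inter> A" using u \<open>B \<subseteq> A\<close> by auto
  qed
  then show ?thesis by (simp add: len_modular[OF BC A])
qed

lemma len_image_le:
  assumes \<psi>: "\<psi> \<in> rmod_hom R M M" and A: "rsubmodule R M A"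
  shows "len (\<psi> ` A) \<le> len A"
  using len_image[OF rmodule_hom_endo[OF \<psi>] A] by simp

text \<open>Applying \<open>\<psi>\<close> removes exactly the length of the part in the kernel, and
  that part is at least as long for \<open>A\<close> as for \<open>B\<close>.\<close>

lemma len_image_exchange:
  assumes \<psi>: "\<psi> \<in> rmod_hom R M M" and A: "rsubmodule R M A" and B: "rsubmodule R M B" and "B \<subseteq> A"
  shows "len (\<psi> ` A) + len B \<le> len (\<psi> ` B) + len A"
proof -
  interpret \<psi>: rmodule_hom R M M \<psi> by (rule rmodule_hom_endo[OF \<psi>])
  note l = len_image[OF \<psi>.rmodule_hom_axioms, folded \<psi>.kernel_def]
  have "len (B \<inter> \<psi>.kernel) \<le> len (A \<inter> \<psi>.kernel)"
    by (intro len_mono rsubmodule_Int \<psi>.rsubmodule_kernel A B) (use \<open>B \<subseteq> A\<close> in auto)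
  then show ?thesis unfolding l[OF A] l[OF B] by (simp add: ac_simps add_mono)
qed

text \<open>For \<open>B \<subseteq> A\<close> and \<open>B' \<subseteq> A'\<close> this says
  \<open>L ((A + \<psi> A') / (B + \<psi> B')) \<le> L (A / B) + L (A' / B')\<close>, without quotients or subtraction.\<close>

lemma len_relative_subadditive:
  assumes \<psi>: "\<psi> \<in> rmod_hom R M M"
    and A: "rsubmodule R M A" and B: "rsubmodule R M B" "B \<subseteq> A"
    and A': "rsubmodule R M A'" and B': "rsubmodule R M B'" "B' \<subseteq> A'"
    and fin: "len A < \<infinity>" "len A' < \<infinity>"
  shows "len (A <+>\<^bsub>M\<^esub> \<psi> ` A') + (len B + len B') \<le> len (B <+>\<^bsub>M\<^esub> \<psi> ` B') + (len A + len A')"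
proof -
  interpret \<psi>: rmodule_hom R M M \<psi> by (rule rmodule_hom_endo[OF \<psi>])
  note im = \<psi>.rsubmodule_image
  have comm: "C <+>\<^bsub>M\<^esub> D = D <+>\<^bsub>M\<^esub> C" if "rsubmodule R M C" "rsubmodule R M D" for C D
    using set_add_upper that by (intro antisym set_add_least rsubmodule_set_add) auto
  \<comment> \<open>The passage from \<open>B + \<psi> B'\<close> to \<open>A + \<psi> A'\<close>
    goes through \<open>A + \<psi> B'\<close>. The lengths \<open>p\<close>, \<open>q\<close>,
    \<open>r\<close> occur on both sides of the three inequalities below and cancel from their sum
    once they are known to be finite.\<close>
  define p q r where "p = len (\<psi> ` B')" and "q = len (A <+>\<^bsub>M\<^esub> \<psi> ` B')" and "r = len (\<psi> ` A')"
  have 1: "len (A <+>\<^bsub>M\<^esub> \<psi> ` A') + p \<le> q + r"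
    unfolding p_def q_def r_def comm[OF A im[OF A']] comm[OF A im[OF B'(1)]]
    by (rule len_exchange) (use A im A' B' in auto)
  have 2: "q + len B \<le> len (B <+>\<^bsub>M\<^esub> \<psi> ` B') + len A"
    unfolding q_def by (rule len_exchange) (use A B B' im in auto)
  have 3: "r + len B' \<le> p + len A'"
    unfolding p_def r_def by (rule len_image_exchange[OF \<psi>]) (use A' B' in auto)
  have r: "r < \<infinity>" using len_image_le[OF \<psi> A'] fin(2) unfolding r_def by (rule le_less_trans)
  have p: "p < \<infinity>" using len_mono[OF im[OF B'(1)] im[OF A']] r B'(2)
    unfolding p_def r_def by (meson image_mono le_less_trans)
  have "q \<le> len A + p" unfolding q_def p_def by (intro len_add_le A im B')
  moreover have "len A + p < \<infinity>" using fin(1) p by simp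
  ultimately have "q < \<infinity>" by (rule le_less_trans)
  then have "p + q + r \<noteq> \<infinity>" using p r by (simp add: less_top)
  moreover have "(p + q + r) + (len (A <+>\<^bsub>M\<^esub> \<psi> ` A') + (len B + len B'))
      \<le> (p + q + r) + (len (B <+>\<^bsub>M\<^esub> \<psi> ` B') + (len A + len A'))"
    using add_mono[OF add_mono[OF 1 2] 3] by (simp add: ac_simps)
  ultimately show ?thesis unfolding ennreal_add_left_cancel_le by blast
qed

lemma len_fg:
  assumes N: "rsubmodule R M N"
  shows "len N = (SUP F\<in>{F. fg_submodule R M F \<and> F \<subseteq> N}. len F)"
  using length_functionD(3)[OF length_function, of "M\<lparr>carrier := N\<rparr>"] rsubmodule_rmodule[OF N]
  by (simp add: Right_Mod_def fg_submodule_sub_iff[OF N])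

end

section \<open>Entropy of a finite submodule\<close>

text \<open>A concave sequence with a non-negative first term has decreasing averages, and a
  decreasing sequence in \<open>ennreal\<close> converges to its infimum.\<close>

lemma concave_quotient_convergent:
  fixes t :: "nat \<Rightarrow> ennreal"
  assumes fin: "\<And>n. t n < \<infinity>" and conc: "\<And>n. t (Suc (Suc n)) + t n \<le> t (Suc n) + t (Suc n)"
  shows "convergent (\<lambda>n. t n / of_nat n)"
proof -
  define r where "r n = enn2real (t n)" for n
  have t: "t n = ennreal (r n)" and r0: "r n \<ge> 0" for n
    using fin[of n] by (auto simp: r_def)
  have conc': "r (Suc (Suc n)) + r n \<le> 2 * r (Suc n)" for n
    using conc[of n] r0 by (simp add: t flip: ennreal_plus)
  \<comment> \<open>The slope of the chord from the origin decreases. The base case is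
    \<open>r 0 \<ge> 0\<close>.\<close>
  have slope: "real n * r (Suc n) \<le> real (Suc n) * r n" for n
  proof (induction n)
    case (Suc n)
    have "real (Suc n) * (r (Suc (Suc n)) + r n) \<le> real (Suc n) * (2 * r (Suc n))"
      by (intro mult_left_mono conc') simp
    then show ?case using Suc by (simp add: algebra_simps)
  qed (use r0 in simp)
  \<comment> \<open>The index starts at 1: the quotient at 0 is 0 when \<open>t 0 = 0\<close>, which
    could break monotonicity. The shift does not affect the limit.\<close>
  have "decseq (\<lambda>n. t (Suc n) / of_nat (Suc n))"
  proof (rule decseq_SucI)
    fix n
    have "r (Suc (Suc n)) / real (Suc (Suc n)) \<le> r (Suc n) / real (Suc n)"
      using slope[of "Suc n"] by (simp add: field_simps)
    then show "t (Suc (Suc n)) / of_nat (Suc (Suc n)) \<le> t (Suc n) / of_nat (Suc n)"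
      using r0 by (simp add: t ennreal_of_nat_eq_real_of_nat divide_ennreal ennreal_leI del: of_nat_Suc)
  qed
  then show ?thesis
    using LIMSEQ_INF convergent_def filterlim_sequentially_Suc by blast
qed

lemma of_nat_mult_divide_ennreal:
  "n > 0 \<Longrightarrow> (of_nat n * c) / of_nat n = (c :: ennreal)"
  by (simp add: ennreal_mult_divide_eq mult.commute[of "of_nat n"])

context length_rmodule
begin

lemma Fin_iff: "F \<in> Fin R L M \<longleftrightarrow> rsubmodule R M F \<and> len F < \<infinity>"
  by (simp add: Fin_def)

lemma Fin_mono: "F \<in> Fin R L M \<Longrightarrow> rsubmodule R M F' \<Longrightarrow> F' \<subseteq> F \<Longrightarrow> F' \<in> Fin R L M"
  unfolding Fin_iff using len_mono le_less_trans by blast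

lemma Fin_set_add:
  assumes "A \<in> Fin R L M" "B \<in> Fin R L M" shows "A <+>\<^bsub>M\<^esub> B \<in> Fin R L M"
proof -
  have "len (A <+>\<^bsub>M\<^esub> B) \<le> len A + len B" using assms len_add_le by (simp add: Fin_iff)
  also have "len A + len B < \<infinity>" using assms by (simp add: Fin_iff)
  finally show ?thesis using assms by (simp add: Fin_iff rsubmodule_set_add)
qed

lemma Fin_image: "\<psi> \<in> rmod_hom R M M \<Longrightarrow> F \<in> Fin R L M \<Longrightarrow> \<psi> ` F \<in> Fin R L M"
  unfolding Fin_iff
  using len_image_le le_less_trans rmodule_hom.rsubmodule_image[OF rmodule_hom_endo] by blast

lemma Fin_trajectory:
  assumes \<phi>: "\<phi> \<in> rmod_hom R M M" and F: "F \<in> Fin R L M"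
  shows "trajectory M \<phi> F n \<in> Fin R L M"
proof (induction n)
  case 0
  then show ?case by (simp add: trajectory_0 Fin_iff rsubmodule_zero len_zero)
next
  case (Suc n)
  then show ?case
    using F trajectory_Suc[OF \<phi> rsubmoduleD(1)] Fin_set_add Fin_image[OF funpow_hom[OF \<phi>] F]
    by (simp add: Fin_iff)
qed

text \<open>\<open>ent_at\<close> is defined by \<open>lim\<close>, which is informative only for a
  convergent sequence; all later estimates of entropies are limits of estimates of averages.\<close>

lemma ent_at_LIMSEQ:
  assumes \<phi>: "\<phi> \<in> rmod_hom R M M" and F: "F \<in> Fin R L M"
  shows "(\<lambda>n. len (trajectory M \<phi> F n) / of_nat n) \<longlonglongrightarrow> ent_at L M \<phi> F"
proof -
  have Fs: "rsubmodule R M F" and Ff: "len F < \<infinity>" using F by (auto simp: Fin_iff)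
  let ?T = "trajectory M \<phi> F"
  note Ts = rsubmodule_trajectory[OF \<phi> Fs]
  have fin: "len (?T n) < \<infinity>" for n using Fin_trajectory[OF assms] by (simp add: Fin_iff)
  have Suc': "F <+>\<^bsub>M\<^esub> \<phi> ` ?T n = ?T (Suc n)" for n
    using trajectory_add[OF \<phi> Fs, of 1 n] trajectory_1[OF \<phi> Fs] by simp
  have mono: "?T n \<subseteq> ?T (Suc n)" for n
    using set_add_upper(1)[OF Ts funpow_image_sub[OF \<phi> Fs], of n n]
    by (simp add: trajectory_Suc[OF \<phi> rsubmoduleD(1)[OF Fs]])
  \<comment> \<open>Concavity is relative subadditivity for the pairs \<open>F \<subseteq> F\<close>
    and \<open>?T n \<subseteq> ?T (Suc n)\<close>, because
    \<open>F + \<phi> (?T n) = ?T (Suc n)\<close>. The finite length of \<open>F\<close>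
    cancels.\<close>
  have "len (?T (Suc (Suc n))) + len (?T n) \<le> len (?T (Suc n)) + len (?T (Suc n))" for n
  proof -
    have "len F + (len (?T (Suc (Suc n))) + len (?T n))
        \<le> len F + (len (?T (Suc n)) + len (?T (Suc n)))"
      using len_relative_subadditive[OF \<phi> Fs Fs order_refl Ts Ts mono Ff fin, of n]
      by (simp add: Suc' ac_simps)
    then show ?thesis unfolding ennreal_add_left_cancel_le using Ff by auto
  qed
  then have "convergent (\<lambda>n. len (?T n) / of_nat n)"
    using fin by (intro concave_quotient_convergent)
  then show ?thesis unfolding ent_at_def convergent_LIMSEQ_iff .
qed

lemma ent_at_mono:
  assumes \<phi>: "\<phi> \<in> rmod_hom R M M" and F: "F \<in> Fin R L M" and F': "rsubmodule R M F'" "F' \<subseteq> F"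
  shows "ent_at L M \<phi> F' \<le> ent_at L M \<phi> F"
proof (rule LIMSEQ_le[OF ent_at_LIMSEQ[OF \<phi> Fin_mono[OF F F']] ent_at_LIMSEQ[OF \<phi> F]])
  have Fs: "rsubmodule R M F" using F by (simp add: Fin_iff)
  have "len (trajectory M \<phi> F' n) / of_nat n \<le> len (trajectory M \<phi> F n) / of_nat n" for n
    by (intro divide_right_mono_ennreal len_mono rsubmodule_trajectory \<phi> F' Fs trajectory_mono)
  then show "\<exists>N. \<forall>n\<ge>N. len (trajectory M \<phi> F' n) / of_nat n \<le> len (trajectory M \<phi> F n) / of_nat n"
    by blast
qed

text \<open>Each new image adds at most \<open>L (F / F')\<close> to the length of the trajectory of
  \<open>F\<close> relative to that of \<open>F'\<close>; averaging over \<open>n\<close> steps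
  leaves this bound.\<close>

lemma ent_at_approx:
  assumes \<phi>: "\<phi> \<in> rmod_hom R M M" and F: "F \<in> Fin R L M" and F': "rsubmodule R M F'" "F' \<subseteq> F"
  shows "ent_at L M \<phi> F + len F' \<le> ent_at L M \<phi> F' + len F"
proof -
  let ?T = "trajectory M \<phi> F" and ?T' = "trajectory M \<phi> F'"
  have Fs: "rsubmodule R M F" and Ff: "len F < \<infinity>" using F by (auto simp: Fin_iff)
  note F'f = Fin_mono[OF F F']
  note Ts = rsubmodule_trajectory[OF \<phi> Fs] rsubmodule_trajectory[OF \<phi> F'(1)]
  note fin = Fin_trajectory[OF \<phi> F, unfolded Fin_iff, THEN conjunct2]
    Fin_trajectory[OF \<phi> F'f, unfolded Fin_iff, THEN conjunct2]
  have step: "len (?T n) + of_nat n * len F' \<le> len (?T' n) + of_nat n * len F" for n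
  proof (induction n)
    case 0
    then show ?case by (simp add: trajectory_0)
  next
    case (Suc n)
    \<comment> \<open>Relative subadditivity with \<open>\<psi> = \<phi> ^^ n\<close> for the pairs
      \<open>?T' n \<subseteq> ?T n\<close> and \<open>F' \<subseteq> F\<close>.\<close>
    have "len (?T (Suc n)) + (len (?T' n) + len F') \<le> len (?T' (Suc n)) + (len (?T n) + len F)"
      unfolding trajectory_Suc[OF \<phi> rsubmoduleD(1)[OF Fs]] trajectory_Suc[OF \<phi> rsubmoduleD(1)[OF F'(1)]]
      by (rule len_relative_subadditive[OF funpow_hom[OF \<phi>] Ts trajectory_mono[OF \<phi> Fs F'(2)] Fs F' fin(1) Ff])
    from add_mono[OF this Suc]
    have "(len (?T n) + len (?T' n)) + (len (?T (Suc n)) + of_nat (Suc n) * len F')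
       \<le> (len (?T n) + len (?T' n)) + (len (?T' (Suc n)) + of_nat (Suc n) * len F)"
      by (simp add: ac_simps distrib_right)
    moreover have "len (?T n) + len (?T' n) \<noteq> \<infinity>" using fin[of n] by auto
    ultimately show ?case unfolding ennreal_add_left_cancel_le by blast
  qed
  have "len (?T n) / of_nat n + len F' \<le> len (?T' n) / of_nat n + len F" if "n \<ge> 1" for n
    using divide_right_mono_ennreal[OF step[of n], of "of_nat n"] that
    by (simp add: add_divide_distrib_ennreal of_nat_mult_divide_ennreal)
  then show ?thesis
    by (intro LIMSEQ_le[OF tendsto_add[OF ent_at_LIMSEQ[OF \<phi> F] tendsto_const]
          tendsto_add[OF ent_at_LIMSEQ[OF \<phi> F'f] tendsto_const]]) blast
qed

lemma fg_Fin: "locally_finite R L M \<Longrightarrow> fg_submodule R M F \<Longrightarrow> F \<in> Fin R L M"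
  by (simp add: locally_finite_def Fin_iff fg_rsubmodule)

text \<open>Upper continuity approximates \<open>L F\<close> by lengths of finitely generated
  submodules of \<open>F\<close>, and \<open>ent_at_approx\<close> transfers the error to the
  entropies.\<close>

lemma ent_eq_SUP_fg:
  assumes lf: "locally_finite R L M" and \<phi>: "\<phi> \<in> rmod_hom R M M"
  shows "ent R L M \<phi> = (SUP F\<in>{F. fg_submodule R M F}. ent_at L M \<phi> F)" (is "_ = ?E")
proof (rule antisym)
  show "?E \<le> ent R L M \<phi>"
    unfolding ent_def by (rule SUP_subset_mono) (use fg_Fin[OF lf] in auto)
  show "ent R L M \<phi> \<le> ?E"
    unfolding ent_def
  proof (rule SUP_least)
    fix F assume F: "F \<in> Fin R L M"
    then have Fs: "rsubmodule R M F" and Ff: "len F < \<infinity>" by (auto simp: Fin_iff)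
    let ?I = "{G. fg_submodule R M G \<and> G \<subseteq> F}"
    have "{\<zero>\<^bsub>M\<^esub>} \<in> ?I" using fg_submodule_zero rsubmoduleD(2)[OF Fs] by simp
    then have ne: "?I \<noteq> {}" by blast
    \<comment> \<open>Carrying \<open>len F\<close> along replaces a subtraction; it is finite and
      cancels at the end. Moving a constant into the supremum uses that the index set is
      nonempty.\<close>
    have "len F + ent_at L M \<phi> F = (SUP G\<in>?I. len G + ent_at L M \<phi> F)"
      by (subst len_fg[OF Fs]) (rule ennreal_SUP_add_left[OF ne, symmetric])
    also have "\<dots> \<le> len F + ?E"
    proof (rule SUP_least)
      fix G assume G: "G \<in> ?I"
      have "len G + ent_at L M \<phi> F \<le> len F + ent_at L M \<phi> G"
        using ent_at_approx[OF \<phi> F] G fg_rsubmodule by (simp add: ac_simps)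
      also have "\<dots> \<le> len F + ?E" using G by (intro add_left_mono SUP_upper) auto
      finally show "len G + ent_at L M \<phi> F \<le> len F + ?E" .
    qed
    finally show "ent_at L M \<phi> F \<le> ?E" using Ff unfolding ennreal_add_left_cancel_le by auto
  qed
qed

end

section \<open>Additivity\<close>

context length_rmodule
begin

text \<open>The kernel is zero, so \<open>len_image\<close> loses nothing. This identifies the
  submodules of \<open>M'\<close> with their images in an extension.\<close>

lemma len_inj_image:
  assumes h: "rmodule_hom R M N h" and inj: "inj_on h (carrier M)" and A: "rsubmodule R M A"
  shows "L (N\<lparr>carrier := h ` A\<rparr>) = len A"
proof -
  interpret h: rmodule_hom R M N h by (rule h)
  have "x = \<zero>\<^bsub>M\<^esub>" if "x \<in> carrier M" "h x = \<zero>\<^bsub>N\<^esub>" for x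
    using inj_onD[OF inj _ that(1) M.zero_closed] that(2) h.hom_zero by simp
  then have "A \<inter> {x \<in> carrier M. h x = \<zero>\<^bsub>N\<^esub>} = {\<zero>\<^bsub>M\<^esub>}"
    using rsubmoduleD(2)[OF A] h.hom_zero M.zero_closed by blast
  then show ?thesis using len_image[OF h A] by (simp add: len_zero)
qed

lemma Fin_inj_image:
  assumes h: "rmodule_hom R M N h" and inj: "inj_on h (carrier M)" and A: "A \<in> Fin R L M"
  shows "h ` A \<in> Fin R L N"
  using A len_inj_image[OF h inj] rmodule_hom.rsubmodule_image[OF h] by (simp add: Fin_def)

lemma ent_at_inj_image:
  assumes h: "rmodule_hom R M N h" and inj: "inj_on h (carrier M)"
    and \<phi>: "\<phi> \<in> rmod_hom R M M" and \<psi>: "\<psi> \<in> rmod_hom R N N"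
    and com: "\<And>x. x \<in> carrier M \<Longrightarrow> h (\<phi> x) = \<psi> (h x)" and A: "rsubmodule R M A"
  shows "ent_at L N \<psi> (h ` A) = ent_at L M \<phi> A"
proof -
  have "L (N\<lparr>carrier := trajectory N \<psi> (h ` A) n\<rparr>) = len (trajectory M \<phi> A n)" for n
    using len_inj_image[OF h inj rsubmodule_trajectory[OF \<phi> A], of n]
      rmodule_hom.image_trajectory[OF h \<phi> \<psi> com A] by simp
  then show ?thesis by (simp add: ent_at_def)
qed

lemma ent_inj_le:
  assumes h: "rmodule_hom R M N h" and inj: "inj_on h (carrier M)"
    and \<phi>: "\<phi> \<in> rmod_hom R M M" and \<psi>: "\<psi> \<in> rmod_hom R N N"
    and com: "\<And>x. x \<in> carrier M \<Longrightarrow> h (\<phi> x) = \<psi> (h x)"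
  shows "ent R L M \<phi> \<le> ent R L N \<psi>"
  unfolding ent_def
proof (rule SUP_mono)
  fix A assume A: "A \<in> Fin R L M"
  have "ent_at L N \<psi> (h ` A) = ent_at L M \<phi> A"
    by (rule ent_at_inj_image[OF h inj \<phi> \<psi> com]) (use A in \<open>simp_all add: Fin_iff\<close>)
  then show "\<exists>B\<in>Fin R L N. ent_at L M \<phi> A \<le> ent_at L N \<psi> B"
    using Fin_inj_image[OF h inj A] by (intro bexI[of _ "h ` A"]) simp_all
qed

end

text \<open>An exact sequence of \<open>R[X]\<close>-modules, seen as \<open>R\<close>-modules with
  intertwined endomorphisms. General \<open>f\<close> and \<open>g\<close> cover both the quotient
  by an invariant submodule and the exact sequences in \<open>lFinX\<close>.\<close>

locale endo_extension = length_rmodule R M L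
  for R (structure) and M :: "('r, 'm) rmod" and L +
  fixes M' M'' :: "('r, 'm) rmod" and f g \<phi>' \<phi> \<phi>'' :: "'m \<Rightarrow> 'm"
  assumes M': "rmodule R M'" and M'': "rmodule R M''"
    and exact: "short_exact R M' M M'' f g"
    and \<phi>': "\<phi>' \<in> rmod_hom R M' M'" and \<phi>: "\<phi> \<in> rmod_hom R M M"
    and \<phi>'': "\<phi>'' \<in> rmod_hom R M'' M''"
    and com_f: "\<And>x. x \<in> carrier M' \<Longrightarrow> f (\<phi>' x) = \<phi> (f x)"
    and com_g: "\<And>x. x \<in> carrier M \<Longrightarrow> g (\<phi> x) = \<phi>'' (g x)"
    and lf: "locally_finite R L M"
begin

lemma exactD:
  shows "f \<in> rmod_hom R M' M" "g \<in> rmod_hom R M M''" and f_inj: "inj_on f (carrier M')"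
    and g_surj: "g ` carrier M = carrier M''"
    and f_image: "f ` carrier M' = {x \<in> carrier M. g x = \<zero>\<^bsub>M''\<^esub>}"
  using exact unfolding short_exact_def by blast+

lemma f_hom: "rmodule_hom R M' M f"
  by (intro rmodule_hom.intro rmodule_hom_axioms.intro M' rmodule_axioms exactD)

lemma g_hom: "rmodule_hom R M M'' g"
  by (intro rmodule_hom.intro rmodule_hom_axioms.intro M'' rmodule_axioms exactD)

interpretation S: length_rmodule R M' L by (rule length_rmodule_other[OF M'])
interpretation Q: length_rmodule R M'' L by (rule length_rmodule_other[OF M''])
interpretation f: rmodule_hom R M' M f by (rule f_hom)
interpretation g: rmodule_hom R M M'' g by (rule g_hom)

abbreviation "T \<equiv> trajectory M \<phi>"

lemma len_ses:
  assumes "rsubmodule R M A"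
  shows "len A = len (A \<inter> g.kernel) + L (M''\<lparr>carrier := g ` A\<rparr>)"
  using len_image[OF g_hom assms] by (simp add: g.kernel_def)

lemma g_Fin: "A \<in> Fin R L M \<Longrightarrow> g ` A \<in> Fin R L M''"
  unfolding Fin_iff Q.Fin_iff using len_ses[of A] g.rsubmodule_image[of A] by simp

lemma locally_finite_quotient: "locally_finite R L M''"
  unfolding locally_finite_def
proof (intro allI impI)
  fix F assume "fg_submodule R M'' F"
  then obtain F' where "fg_submodule R M F'" "g ` F' = F"
    using g.fg_submodule_lift[OF g_surj] by blast
  then show "L (M''\<lparr>carrier := F\<rparr>) < \<infinity>"
    using g_Fin[OF fg_Fin[OF lf]] Q.Fin_iff by blast
qed

text \<open>By exactness \<open>A\<close> is the image under \<open>f\<close> of its preimage in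
  \<open>M'\<close>, and injective maps preserve length and trajectories.\<close>

lemma ent_at_kernel_le:
  assumes A: "A \<in> Fin R L M" and K: "A \<subseteq> g.kernel"
  shows "ent_at L M \<phi> A \<le> ent R L M' \<phi>'"
proof -
  have As: "rsubmodule R M A" using A by (simp add: Fin_iff)
  define B where "B = {y \<in> carrier M'. f y \<in> A}"
  have Bs: "rsubmodule R M' B" unfolding B_def by (rule f.rsubmodule_vimage[OF As])
  have fB: "f ` B = A" using K f_image unfolding g.kernel_def[symmetric] B_def by auto
  have "B \<in> Fin R L M'"
    using A S.len_inj_image[OF f_hom f_inj Bs] Bs by (simp add: Fin_def fB)
  moreover have "ent_at L M \<phi> A = ent_at L M' \<phi>' B"
    using S.ent_at_inj_image[OF f_hom f_inj \<phi>' \<phi> com_f Bs] by (simp add: fB)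
  ultimately show ?thesis unfolding ent_def by (simp add: SUP_upper)
qed

lemma funpow_kernel: "(\<phi> ^^ i) ` g.kernel \<subseteq> g.kernel"
proof
  fix y assume "y \<in> (\<phi> ^^ i) ` g.kernel"
  then obtain x where x: "x \<in> carrier M" "g x = \<zero>\<^bsub>M''\<^esub>" "y = (\<phi> ^^ i) x"
    by (auto simp: g.kernel_def)
  have "g y = (\<phi>'' ^^ i) \<zero>\<^bsub>M''\<^esub>"
    using g.funpow_intertwine[OF \<phi> com_g x(1)] x by simp
  also have "\<dots> = \<zero>\<^bsub>M''\<^esub>"
    by (rule rmodule_hom.hom_zero[OF Q.rmodule_hom_endo[OF Q.funpow_hom[OF \<phi>'']]])
  finally show "y \<in> g.kernel"
    using x rmod_homD(1)[OF funpow_hom[OF \<phi>]] by (simp add: g.kernel_def)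
qed

text \<open>An element of the left side is \<open>a \<oplus> b\<close> with
  \<open>a \<in> T F m\<close> and \<open>b \<in> T N m\<close>. The kernel is invariant, so it
  contains \<open>b\<close> and hence \<open>a\<close>; thus \<open>a \<in> N\<close>, and
  \<open>N \<subseteq> T N m\<close> because \<open>m > 0\<close>.\<close>

lemma trajectory_sum_kernel:
  fixes m and F
  defines "N \<equiv> T F m \<inter> g.kernel"
  assumes F: "rsubmodule R M F" and m: "m > 0"
  shows "T (F <+>\<^bsub>M\<^esub> N) m \<inter> g.kernel \<subseteq> T N m"
proof
  note Ts = rsubmodule_trajectory[OF \<phi>]
  note K = g.rsubmodule_kernel
  have N: "rsubmodule R M N" unfolding N_def by (intro rsubmodule_Int Ts F K)
  note c = rsubmoduleD(1)
  note u = set_add_upper[OF Ts[OF F, of m] Ts[OF N, of m]]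
  have NT: "N \<subseteq> T N m" using funpow_image_trajectory[OF \<phi> N m] by simp
  have TNK: "T N m \<subseteq> g.kernel"
    by (rule trajectory_least[OF \<phi> c[OF N] K]) (use funpow_kernel N_def in blast)
  have "T (F <+>\<^bsub>M\<^esub> N) m \<subseteq> T F m <+>\<^bsub>M\<^esub> T N m"
  proof (rule trajectory_least[OF \<phi>])
    fix i assume i: "i < m"
    interpret P: rmodule_hom R M M "\<phi> ^^ i" by (rule rmodule_hom_endo[OF funpow_hom[OF \<phi>]])
    show "(\<phi> ^^ i) ` (F <+>\<^bsub>M\<^esub> N) \<subseteq> T F m <+>\<^bsub>M\<^esub> T N m"
      unfolding P.image_set_add[OF c[OF F] c[OF N]]
      using funpow_image_trajectory[OF \<phi> F i] funpow_image_trajectory[OF \<phi> N i] u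
      by (intro set_add_least rsubmodule_set_add Ts F N) blast+
  qed (intro c rsubmodule_set_add Ts F N)+
  moreover fix x assume x: "x \<in> T (F <+>\<^bsub>M\<^esub> N) m \<inter> g.kernel"
  ultimately obtain a b where a: "a \<in> T F m" and b: "b \<in> T N m" and ab: "x = a \<oplus>\<^bsub>M\<^esub> b"
    by (blast elim: set_add_memE)
  have ac: "a \<in> carrier M" and bc: "b \<in> carrier M" using a b c[OF Ts[OF F]] c[OF Ts[OF N]] by auto
  have "a = x \<oplus>\<^bsub>M\<^esub> \<ominus>\<^bsub>M\<^esub> b" using ac bc ab by (simp add: M.a_assoc M.r_neg)
  also have "\<dots> \<in> g.kernel"
    using x b TNK by (intro rsubmoduleD(3,5)[OF K]) auto
  finally have "a \<in> N" using a by (simp add: N_def)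
  then show "x \<in> T N m" using NT b ab rsubmoduleD(3)[OF Ts[OF N]] by blast
qed

lemma ent_at_le_step:
  assumes F: "F \<in> Fin R L M" and m: "m > 0"
  shows "ent_at L M \<phi> F
    \<le> ent R L M' \<phi>' + L (M''\<lparr>carrier := trajectory M'' \<phi>'' (g ` F) m\<rparr>) / of_nat m"
proof -
  define N where "N = T F m \<inter> g.kernel"
  \<comment> \<open>Adding \<open>N\<close> makes the pair \<open>N \<subseteq> G\<close> available
    for relative lengths without changing the image under \<open>g\<close>.\<close>
  define G where "G = F <+>\<^bsub>M\<^esub> N"
  define c where "c = L (M''\<lparr>carrier := trajectory M'' \<phi>'' (g ` F) m\<rparr>)"
  note K = g.rsubmodule_kernel
  have Fs: "rsubmodule R M F" using F by (simp add: Fin_iff)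
  have Ns: "rsubmodule R M N" unfolding N_def by (intro rsubmodule_Int rsubmodule_trajectory \<phi> Fs K)
  have N: "N \<in> Fin R L M" by (rule Fin_mono[OF Fin_trajectory[OF \<phi> F, of m] Ns]) (simp add: N_def)
  have G: "G \<in> Fin R L M" unfolding G_def by (rule Fin_set_add[OF F N])
  then have Gs: "rsubmodule R M G" by (simp add: Fin_iff)
  have FG: "F \<subseteq> G" and NG: "N \<subseteq> G" unfolding G_def by (intro set_add_upper Fs Ns)+
  have gG: "g ` G = g ` F"
  proof
    have "g (a \<oplus>\<^bsub>M\<^esub> b) = g a" if "a \<in> F" "b \<in> N" for a b
    proof -
      have "a \<in> carrier M" "b \<in> carrier M" "g b = \<zero>\<^bsub>M''\<^esub>"
        using that rsubmoduleD(1)[OF Fs] by (auto simp: N_def g.kernel_def)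
      then show ?thesis by (simp add: g.homD)
    qed
    then show "g ` G \<subseteq> g ` F" unfolding G_def by (auto elim!: set_add_memE)
  qed (use FG in blast)
  have fin: "len (T G n) < \<infinity>" "len (T N n) < \<infinity>" for n
    using Fin_trajectory[OF \<phi> G] Fin_trajectory[OF \<phi> N] by (simp_all add: Fin_iff)
  have block: "len (T G m) \<le> len (T N m) + c"
  proof -
    have "len (T G m) = len (T G m \<inter> g.kernel) + c"
      using len_ses[OF rsubmodule_trajectory[OF \<phi> Gs]] g.image_trajectory[OF \<phi> \<phi>'' com_g Gs]
      by (simp add: c_def gG)
    also have "\<dots> \<le> len (T N m) + c"
      using trajectory_sum_kernel[OF Fs m] unfolding N_def[symmetric] G_def[symmetric]
      by (intro add_right_mono len_mono rsubmodule_Int rsubmodule_trajectory \<phi> Gs Ns K)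
    finally show ?thesis .
  qed
  \<comment> \<open>A trajectory of length \<open>q * m\<close> is cut into \<open>q\<close> blocks
    of length \<open>m\<close>; by relative subadditivity with
    \<open>\<psi> = \<phi> ^^ (q * m)\<close> each block adds at most \<open>c\<close> to the
    relative length.\<close>
  have blocks: "len (T G (q * m)) \<le> len (T N (q * m)) + of_nat q * c" for q
  proof (induction q)
    case (Suc q)
    let ?u = "len (T N (q * m)) + len (T N m)"
    note Ts = rsubmodule_trajectory[OF \<phi> Gs] rsubmodule_trajectory[OF \<phi> Ns]
    note TT = trajectory_mono[OF \<phi> Gs NG]
    have "len (T G (q * m + m)) + ?u \<le> len (T N (q * m + m)) + (len (T G (q * m)) + len (T G m))"
      unfolding trajectory_add[OF \<phi> Gs] trajectory_add[OF \<phi> Ns]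
      by (rule len_relative_subadditive[OF funpow_hom[OF \<phi>] Ts TT Ts TT fin(1) fin(1)])
    also have "\<dots> \<le> len (T N (q * m + m)) + ((len (T N (q * m)) + of_nat q * c) + (len (T N m) + c))"
      by (intro add_left_mono add_mono Suc block)
    finally have "?u + len (T G (Suc q * m)) \<le> ?u + (len (T N (Suc q * m)) + of_nat (Suc q) * c)"
      by (simp add: ac_simps distrib_left)
    moreover have "?u \<noteq> \<infinity>" using fin(2)[of "q * m"] fin(2)[of m] by auto
    ultimately show ?case unfolding ennreal_add_left_cancel_le by blast
  qed (simp add: trajectory_0)
  have "len (T G (q * m)) / of_nat (q * m) \<le> len (T N (q * m)) / of_nat (q * m) + c / of_nat m"
    if "q \<ge> 1" for q
  proof -
    have "c = of_nat m * (c / of_nat m)"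
      using m by (simp add: ennreal_times_divide of_nat_mult_divide_ennreal)
    then have "of_nat q * c = of_nat (q * m) * (c / of_nat m)"
      by (simp add: mult.assoc)
    then show ?thesis
      using divide_right_mono_ennreal[OF blocks[of q], of "of_nat (q * m)"] that m
        of_nat_mult_divide_ennreal[of "q * m" "c / of_nat m"]
      by (simp add: add_divide_distrib_ennreal del: of_nat_mult)
  qed
  \<comment> \<open>Averages along the multiples of \<open>m\<close> have the same limits as the
    full sequences.\<close>
  moreover have "strict_mono (\<lambda>q. q * m)" using m by (simp add: strict_mono_def)
  note sub = LIMSEQ_subseq_LIMSEQ[OF ent_at_LIMSEQ[OF \<phi> G] this, unfolded o_def]
    LIMSEQ_subseq_LIMSEQ[OF ent_at_LIMSEQ[OF \<phi> N] this, unfolded o_def]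
  ultimately have "ent_at L M \<phi> G \<le> ent_at L M \<phi> N + c / of_nat m"
    by (intro LIMSEQ_le[OF sub(1) tendsto_add[OF sub(2) tendsto_const]]) blast
  also have "\<dots> \<le> ent R L M' \<phi>' + c / of_nat m"
    by (intro add_right_mono ent_at_kernel_le N) (simp add: N_def)
  finally show ?thesis using ent_at_mono[OF \<phi> G Fs FG] unfolding c_def by (rule order_trans[rotated])
qed

lemma ent_le: "ent R L M \<phi> \<le> ent R L M' \<phi>' + ent R L M'' \<phi>''"
  unfolding ent_def[of R L M]
proof (rule SUP_least)
  fix F assume F: "F \<in> Fin R L M"
  note gF = g_Fin[OF F]
  have "ent_at L M \<phi> F \<le> ent R L M' \<phi>' + ent_at L M'' \<phi>'' (g ` F)"
    by (rule LIMSEQ_le_const[OF tendsto_add[OF tendsto_const Q.ent_at_LIMSEQ[OF \<phi>'' gF]]])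
       (use ent_at_le_step[OF F] in \<open>auto intro!: exI[of _ 1]\<close>)
  also have "\<dots> \<le> ent R L M' \<phi>' + ent R L M'' \<phi>''"
    unfolding ent_def[of R L M''] by (intro add_left_mono SUP_upper gF)
  finally show "ent_at L M \<phi> F \<le> ent R L M' \<phi>' + ent R L M'' \<phi>''" .
qed

lemma ent_at_sum_le:
  assumes A: "A \<in> Fin R L M'" and F: "fg_submodule R M'' F"
  shows "ent_at L M' \<phi>' A + ent_at L M'' \<phi>'' F \<le> ent R L M \<phi>"
proof -
  obtain B where B: "fg_submodule R M B" "g ` B = F"
    using g.fg_submodule_lift[OF g_surj F] by blast
  define H where "H = f ` A <+>\<^bsub>M\<^esub> B"
  have As: "rsubmodule R M' A" using A by (simp add: Fin_def)
  have fA: "f ` A \<in> Fin R L M" by (rule S.Fin_inj_image[OF f_hom f_inj A])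
  then have fAs: "rsubmodule R M (f ` A)" by (simp add: Fin_iff)
  have Bs: "rsubmodule R M B" by (rule fg_rsubmodule[OF B(1)])
  have H: "H \<in> Fin R L M" unfolding H_def by (intro Fin_set_add fA fg_Fin[OF lf B(1)])
  then have Hs: "rsubmodule R M H" by (simp add: Fin_iff)
  have fAH: "f ` A \<subseteq> H" and BH: "B \<subseteq> H" unfolding H_def by (intro set_add_upper fAs Bs)+
  have fAK: "f ` A \<subseteq> g.kernel"
    using S.rsubmoduleD(1)[OF As] f_image by (auto simp: g.kernel_def)
  have gH: "F \<subseteq> g ` H" using B BH by blast
  note K = g.rsubmodule_kernel
  have F': "F \<in> Fin R L M''" by (rule Q.fg_Fin[OF locally_finite_quotient F])
  then have Fs: "rsubmodule R M'' F" by (simp add: Q.Fin_iff)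
  note lim = tendsto_add[OF ent_at_LIMSEQ[OF \<phi> fA] Q.ent_at_LIMSEQ[OF \<phi>'' F']]
  have "len (T (f ` A) n) / of_nat n + L (M''\<lparr>carrier := trajectory M'' \<phi>'' F n\<rparr>) / of_nat n
      \<le> len (T H n) / of_nat n" for n
  proof -
    have "T (f ` A) n \<subseteq> g.kernel"
      by (rule trajectory_least[OF \<phi> rsubmoduleD(1)[OF fAs] K]) (use fAK funpow_kernel in blast)
    then have "T (f ` A) n \<subseteq> T H n \<inter> g.kernel" using trajectory_mono[OF \<phi> Hs fAH] by blast
    then have "len (T (f ` A) n) + L (M''\<lparr>carrier := trajectory M'' \<phi>'' F n\<rparr>)
       \<le> len (T H n \<inter> g.kernel) + L (M''\<lparr>carrier := trajectory M'' \<phi>'' (g ` H) n\<rparr>)"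
      by (intro add_mono len_mono Q.len_mono rsubmodule_Int rsubmodule_trajectory Q.rsubmodule_trajectory
          Q.trajectory_mono gH \<phi> \<phi>'' Hs fAs K Fs g.rsubmodule_image)
    also have "\<dots> = len (T H n)"
      using len_ses[OF rsubmodule_trajectory[OF \<phi> Hs]] g.image_trajectory[OF \<phi> \<phi>'' com_g Hs] by simp
    finally show ?thesis
      unfolding add_divide_distrib_ennreal[symmetric] by (rule divide_right_mono_ennreal)
  qed
  then have "ent_at L M \<phi> (f ` A) + ent_at L M'' \<phi>'' F \<le> ent_at L M \<phi> H"
    by (intro LIMSEQ_le[OF lim ent_at_LIMSEQ[OF \<phi> H]]) blast
  also have "\<dots> \<le> ent R L M \<phi>" unfolding ent_def by (rule SUP_upper[OF H])
  finally show ?thesis using S.ent_at_inj_image[OF f_hom f_inj \<phi>' \<phi> com_f As] by simp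
qed

theorem ent_additive: "ent R L M \<phi> = ent R L M' \<phi>' + ent R L M'' \<phi>''"
proof (rule antisym[OF ent_le])
  let ?I = "{F. fg_submodule R M'' F}"
  have ne: "?I \<noteq> {}" "Fin R L M' \<noteq> {}"
    using Q.fg_submodule_zero S.rsubmodule_zero S.len_zero S.Fin_iff[of "{\<zero>\<^bsub>M'\<^esub>}"] by auto
  \<comment> \<open>The two suprema are pulled out one after the other. For the quotient it runs
    over finitely generated submodules, since those are the ones that \<open>ent_at_sum_le\<close>
    lifts.\<close>
  have "ent R L M' \<phi>' + ent R L M'' \<phi>''
      = (SUP A\<in>Fin R L M'. ent_at L M' \<phi>' A + ent R L M'' \<phi>'')"
    unfolding ent_def[of R L M'] by (rule ennreal_SUP_add_left[OF ne(2), symmetric])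
  also have "\<dots> \<le> ent R L M \<phi>"
  proof (rule SUP_least)
    fix A assume A: "A \<in> Fin R L M'"
    have "ent_at L M' \<phi>' A + ent R L M'' \<phi>''
        = (SUP F\<in>?I. ent_at L M'' \<phi>'' F + ent_at L M' \<phi>' A)"
      unfolding Q.ent_eq_SUP_fg[OF locally_finite_quotient \<phi>''] ennreal_SUP_add_left[OF ne(1)]
      by (rule add.commute)
    also have "\<dots> \<le> ent R L M \<phi>"
      by (rule SUP_least) (use ent_at_sum_le[OF A] in \<open>simp add: add.commute\<close>)
    finally show "ent_at L M' \<phi>' A + ent R L M'' \<phi>'' \<le> ent R L M \<phi>" .
  qed
  finally show "ent R L M' \<phi>' + ent R L M'' \<phi>'' \<le> ent R L M \<phi>" .
qed

end

section \<open>Invariant submodules and their quotients\<close>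

lemma (in rmodule) restrict_hom:
  assumes \<phi>: "\<phi> \<in> rmod_hom R M M" and N: "rsubmodule R M N" and inv: "\<phi> ` N \<subseteq> N"
  shows "restrict \<phi> N \<in> rmod_hom R (M\<lparr>carrier := N\<rparr>) (M\<lparr>carrier := N\<rparr>)"
proof -
  note D = rsubmoduleD[OF N]
  have "x \<in> carrier M" "\<phi> x \<in> N" if "x \<in> N" for x using that D(1) inv by auto
  then show ?thesis using rmod_homD[OF \<phi>] by (simp add: rmod_hom_def D)
qed

lemma (in rmodule) quot_map_hom:
  assumes \<phi>: "\<phi> \<in> rmod_hom R M M" and N: "rsubmodule R M N" and inv: "\<phi> ` N \<subseteq> N"
  shows "quot_map M N \<phi> \<in> rmod_hom R (quot_rmod M N) (quot_rmod M N)"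
proof -
  let ?p = "coset_rep M N" and ?Q = "quot_rmod M N"
  note p = rmod_homD[OF quot_rmod_is_quotient(1)[OF N]]
  note \<phi>D = rmod_homD[OF \<phi>]
  note q = quot_map_coset_rep[OF N \<phi> inv]
  have add: "quot_map M N \<phi> (?p x \<oplus>\<^bsub>?Q\<^esub> ?p y) = quot_map M N \<phi> (?p x) \<oplus>\<^bsub>?Q\<^esub> quot_map M N \<phi> (?p y)"
    if "x \<in> carrier M" "y \<in> carrier M" for x y
    using that by (simp add: q \<phi>D flip: p(2))
  have act: "quot_map M N \<phi> (?p x \<cdot>\<^bsub>?Q\<^esub> r) = quot_map M N \<phi> (?p x) \<cdot>\<^bsub>?Q\<^esub> r"
    if "x \<in> carrier M" "r \<in> carrier R" for x r
    using that by (simp add: q \<phi>D flip: p(3))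
  have cl: "quot_map M N \<phi> (?p x) \<in> carrier ?Q" if "x \<in> carrier M" for x
    using that by (simp add: q \<phi>D p(1))
  show ?thesis
    unfolding rmod_hom_def quot_rmod_is_quotient(2)[OF N, symmetric]
    using add act cl unfolding quot_rmod_is_quotient(2)[OF N, symmetric] by blast
qed

lemma (in rmodule) short_exact_quot_rmod:
  assumes N: "rsubmodule R M N"
  shows "short_exact R (M\<lparr>carrier := N\<rparr>) M (quot_rmod M N) (\<lambda>x. x) (coset_rep M N)"
  unfolding short_exact_def quot_rmod_is_quotient(3)[OF N]
  using quot_rmod_is_quotient(1,2)[OF N] rsubmoduleD(1)[OF N]
  by (simp add: rmod_hom_def subset_iff)

section \<open>Modules over the polynomial ring\<close>

lemma base_rmod_simps [simp]:
  "carrier (base_rmod R V) = carrier V" "\<zero>\<^bsub>base_rmod R V\<^esub> = \<zero>\<^bsub>V\<^esub>"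
  "x \<oplus>\<^bsub>base_rmod R V\<^esub> y = x \<oplus>\<^bsub>V\<^esub> y" "x \<cdot>\<^bsub>base_rmod R V\<^esub> r = x \<cdot>\<^bsub>V\<^esub> monom (UP R) r 0"
  by (simp_all add: base_rmod_def)

lemma base_rmod_sub [simp]: "base_rmod R (V\<lparr>carrier := W\<rparr>) = base_rmod R V\<lparr>carrier := W\<rparr>"
  and X_act_sub [simp]: "X_act R (V\<lparr>carrier := W\<rparr>) = X_act R V"
  by (simp_all add: base_rmod_def X_act_def fun_eq_iff)

locale ring_length_function = R: ring R for R (structure) +
  fixes L :: "('a, 'm) rmod \<Rightarrow> ennreal"
  assumes length_function: "length_function R (Right_Mod R) L"
begin

interpretation U: UP_ring R "UP R" by unfold_locales

lemma length_rmoduleI: "rmodule R M \<Longrightarrow> length_rmodule R M L"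
  by (intro length_rmodule.intro length_rmodule_axioms.intro length_function)

lemma lFinXD:
  assumes "V \<in> lFinX R L"
  shows "rmodule (UP R) V" "length_rmodule R (base_rmod R V) L" "locally_finite R L (base_rmod R V)"
    "X_act R V \<in> rmod_hom R (base_rmod R V) (base_rmod R V)"
proof -
  show V: "rmodule (UP R) V" and "locally_finite R L (base_rmod R V)"
    using assms by (simp_all add: lFinX_def Right_Mod_def)
  show "length_rmodule R (base_rmod R V) L"
    by (intro length_rmoduleI poly_rmodule_eq(1) R.ring_axioms V)
  show "X_act R V \<in> rmod_hom R (base_rmod R V) (base_rmod R V)"
    by (intro poly_rmodule_eq(2) R.ring_axioms V)
qed

text \<open>Constants and \<open>X\<close> both act through elements of \<open>UP R\<close>, so
  compatibility with them is part of linearity over the polynomial ring.\<close>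

lemma base_rmod_hom:
  assumes "h \<in> rmod_hom (UP R) V W"
  shows "h \<in> rmod_hom R (base_rmod R V) (base_rmod R W)"
    and "x \<in> carrier V \<Longrightarrow> h (X_act R V x) = X_act R W (h x)"
  using rmod_homD[OF assms] by (simp_all add: rmod_hom_def X_act_def)

lemma rsubmodule_base_rmod:
  assumes V: "rmodule (UP R) V" and W: "rsubmodule (UP R) V W"
  shows "rsubmodule R (base_rmod R V) W" and "X_act R V ` W \<subseteq> W"
proof -
  interpret V: rmodule "UP R" V by (rule V)
  interpret B: rmodule R "base_rmod R V" by (rule poly_rmodule_eq(1)[OF R.ring_axioms V])
  note D = V.rsubmoduleD[OF W]
  show "rsubmodule R (base_rmod R V) W" by (rule B.rsubmoduleI) (simp_all add: D)
  show "X_act R V ` W \<subseteq> W" by (auto simp: X_act_def D)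
qed

lemma lFinX_sub:
  assumes V: "V \<in> lFinX R L" and W: "rsubmodule (UP R) V W"
  shows "V\<lparr>carrier := W\<rparr> \<in> lFinX R L"
proof -
  note VD = lFinXD[OF V]
  interpret V: rmodule "UP R" V by (rule VD)
  interpret B: length_rmodule R "base_rmod R V" L by (rule VD)
  have "locally_finite R L (base_rmod R V\<lparr>carrier := W\<rparr>)"
    unfolding locally_finite_def B.fg_submodule_sub_iff[OF rsubmodule_base_rmod(1)[OF VD(1) W]]
    using VD(3) by (simp add: locally_finite_def)
  then show ?thesis by (simp add: lFinX_def Right_Mod_def V.rsubmodule_rmodule[OF W])
qed

section \<open>The axioms of a length function for entropy\<close>

lemma entX_zero:
  assumes V: "V \<in> lFinX R L" and z: "carrier V = {\<zero>\<^bsub>V\<^esub>}"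
  shows "entX R L V = 0"
proof -
  note VD = lFinXD[OF V]
  interpret B: length_rmodule R "base_rmod R V" L by (rule VD)
  let ?B = "base_rmod R V" and ?X = "X_act R V"
  have "ent_at L ?B ?X F \<le> 0" if F: "F \<in> Fin R L ?B" for F
  proof (rule LIMSEQ_le_const2[OF B.ent_at_LIMSEQ[OF VD(4) F]])
    have Fs: "rsubmodule R ?B F" using F by (simp add: B.Fin_iff)
    have "trajectory ?B ?X F n = {\<zero>\<^bsub>?B\<^esub>}" for n
      using B.rsubmoduleD(1,2)[OF B.rsubmodule_trajectory[OF VD(4) Fs, of n]] z by auto
    then show "\<exists>N. \<forall>n\<ge>N. L (?B\<lparr>carrier := trajectory ?B ?X F n\<rparr>) / of_nat n \<le> 0"
      by (simp only: B.len_zero) simp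
  qed
  then have "entX R L V \<le> 0" unfolding entX_def ent_def by (rule SUP_least)
  then show ?thesis by simp
qed

lemma entX_additive:
  assumes V: "V' \<in> lFinX R L" "V \<in> lFinX R L" "V'' \<in> lFinX R L"
    and ex: "short_exact (UP R) V' V V'' f g"
  shows "entX R L V = entX R L V' + entX R L V''"
proof -
  have f: "f \<in> rmod_hom (UP R) V' V" and g: "g \<in> rmod_hom (UP R) V V''"
    using ex by (simp_all add: short_exact_def)
  have "endo_extension R (base_rmod R V) L (base_rmod R V') (base_rmod R V'') f g
      (X_act R V') (X_act R V) (X_act R V'')"
  proof (intro endo_extension.intro endo_extension_axioms.intro lFinXD V)
    show "short_exact R (base_rmod R V') (base_rmod R V) (base_rmod R V'') f g"
      using ex base_rmod_hom(1)[OF f] base_rmod_hom(1)[OF g] by (simp add: short_exact_def)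
    show "rmodule R (base_rmod R V')" "rmodule R (base_rmod R V'')"
      using lFinXD(2)[OF V(1)] lFinXD(2)[OF V(3)] by (simp_all add: length_rmodule_def)
  qed (use base_rmod_hom(2)[OF f] base_rmod_hom(2)[OF g] in simp_all)
  then show ?thesis unfolding entX_def by (rule endo_extension.ent_additive)
qed

text \<open>Invariance follows from additivity: an isomorphism is the surjection of an exact
  sequence whose first term is the zero submodule.\<close>

lemma entX_iso:
  assumes V: "V \<in> lFinX R L" "W \<in> lFinX R L" and iso: "rmod_iso (UP R) V W"
  shows "entX R L V = entX R L W"
proof -
  interpret V: rmodule "UP R" V by (rule lFinXD[OF V(1)])
  interpret W: rmodule "UP R" W by (rule lFinXD[OF V(2)])
  obtain h where h: "h \<in> rmod_hom (UP R) V W" and b: "bij_betw h (carrier V) (carrier W)"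
    using iso by (auto simp: rmod_iso_def)
  interpret h: rmodule_hom "UP R" V W h
    by (intro rmodule_hom.intro rmodule_hom_axioms.intro h V.rmodule_axioms W.rmodule_axioms)
  let ?Z = "V\<lparr>carrier := {\<zero>\<^bsub>V\<^esub>}\<rparr>"
  have Z: "?Z \<in> lFinX R L" by (rule lFinX_sub[OF V(1) V.rsubmodule_zero])
  have "x = \<zero>\<^bsub>V\<^esub>" if "x \<in> carrier V" "h x = \<zero>\<^bsub>W\<^esub>" for x
    using inj_onD[OF bij_betw_imp_inj_on[OF b] _ that(1) V.M.zero_closed] that(2) h.hom_zero by simp
  then have ker: "{x \<in> carrier V. h x = \<zero>\<^bsub>W\<^esub>} = {\<zero>\<^bsub>V\<^esub>}"
    using h.hom_zero V.M.zero_closed by blast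
  have "short_exact (UP R) ?Z V W (\<lambda>x. x) h"
    unfolding short_exact_def ker using h bij_betw_imp_surj_on[OF b]
    by (simp add: rmod_hom_def V.zero_ract)
  then have "entX R L V = entX R L ?Z + entX R L W" by (rule entX_additive[OF Z V])
  then show ?thesis using entX_zero[OF Z] by simp
qed

text \<open>Monotonicity under inclusions gives one inequality. For the other, the entropy is a
  supremum over finitely generated \<open>R\<close>-submodules, and each of them lies in the
  finitely generated \<open>R[X]\<close>-submodule with the same generators.\<close>

lemma entX_fg:
  assumes V: "V \<in> lFinX R L"
  shows "entX R L V = (SUP W\<in>{W. fg_submodule (UP R) V W}. entX R L (V\<lparr>carrier := W\<rparr>))"
    (is "_ = ?E")
proof (rule antisym)
  note VD = lFinXD[OF V]
  interpret V: rmodule "UP R" V by (rule VD)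
  interpret B: length_rmodule R "base_rmod R V" L by (rule VD)
  let ?B = "base_rmod R V" and ?X = "X_act R V"
  have sub: "length_rmodule R (?B\<lparr>carrier := W\<rparr>) L"
    "rmodule_hom R (?B\<lparr>carrier := W\<rparr>) ?B (\<lambda>x. x)" "?X \<in> rmod_hom R (?B\<lparr>carrier := W\<rparr>) (?B\<lparr>carrier := W\<rparr>)"
    if W: "rsubmodule (UP R) V W" for W
  proof -
    note lFinXD[OF lFinX_sub[OF V W], unfolded base_rmod_sub X_act_sub]
    then show B': "length_rmodule R (?B\<lparr>carrier := W\<rparr>) L"
      and "?X \<in> rmod_hom R (?B\<lparr>carrier := W\<rparr>) (?B\<lparr>carrier := W\<rparr>)" by simp_all
    show "rmodule_hom R (?B\<lparr>carrier := W\<rparr>) ?B (\<lambda>x. x)"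
      using B' V.rsubmoduleD(1)[OF W]
      by (intro rmodule_hom.intro rmodule_hom_axioms.intro B.rmodule_axioms)
         (simp_all add: length_rmodule_def rmod_hom_def subset_iff)
  qed
  show "?E \<le> entX R L V"
  proof (rule SUP_least)
    fix W assume "W \<in> {W. fg_submodule (UP R) V W}"
    then have W: "rsubmodule (UP R) V W" by (simp add: V.fg_rsubmodule)
    show "entX R L (V\<lparr>carrier := W\<rparr>) \<le> entX R L V"
      unfolding entX_def base_rmod_sub X_act_sub
      by (rule length_rmodule.ent_inj_le[OF sub(1,2)[OF W] _ sub(3)[OF W] VD(4)]) simp_all
  qed
  show "entX R L V \<le> ?E"
    unfolding entX_def[of R L V] B.ent_eq_SUP_fg[OF VD(3,4)]
  proof (rule SUP_least)
    fix F assume F: "F \<in> {F. fg_submodule R ?B F}"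
    then have Ff: "F \<in> Fin R L ?B" using B.fg_Fin[OF VD(3)] by simp
    obtain A where A: "finite A" "A \<subseteq> carrier V" "F = rsubmodule R ?B hull A"
      using F by (auto simp: fg_submodule_def)
    define W where "W = rsubmodule (UP R) V hull A"
    have W: "fg_submodule (UP R) V W" using A by (auto simp: fg_submodule_def W_def)
    have Ws: "rsubmodule (UP R) V W" by (rule V.fg_rsubmodule[OF W])
    note WB = rsubmodule_base_rmod(1)[OF VD(1) Ws]
    have "F \<subseteq> W" unfolding A(3) by (rule hull_minimal) (simp_all add: W_def hull_subset WB[unfolded W_def])
    then have Fs: "rsubmodule R (?B\<lparr>carrier := W\<rparr>) F"
      using Ff by (simp add: B.rsubmodule_sub_iff[OF WB] B.Fin_iff)
    then have FW: "F \<in> Fin R L (?B\<lparr>carrier := W\<rparr>)" using Ff by (simp add: Fin_def)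
    \<comment> \<open>The inclusion of \<open>W\<close> preserves lengths and trajectories, so the
      entropy of \<open>F\<close> may be computed inside \<open>W\<close>.\<close>
    have "ent_at L ?B ?X ((\<lambda>x. x) ` F) = ent_at L (?B\<lparr>carrier := W\<rparr>) ?X F"
      by (rule length_rmodule.ent_at_inj_image[OF sub(1,2)[OF Ws] _ sub(3)[OF Ws] VD(4) _ Fs]) simp_all
    then have "ent_at L ?B ?X F = ent_at L (?B\<lparr>carrier := W\<rparr>) ?X F" by simp
    also have "\<dots> \<le> entX R L (V\<lparr>carrier := W\<rparr>)"
      unfolding entX_def base_rmod_sub X_act_sub ent_def by (rule SUP_upper[OF FW])
    also have "\<dots> \<le> ?E" using W by (intro SUP_upper) simp
    finally show "ent_at L ?B ?X F \<le> ?E" .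
  qed
qed

lemma length_function_entX: "length_function (UP R) (lFinX R L) (entX R L)"
  unfolding length_function_def
  using entX_zero entX_iso entX_additive entX_fg by meson

lemma ent_additive_quotient:
  assumes M: "rmodule R M" and \<phi>: "\<phi> \<in> rmod_hom R M M"
    and lf: "poly_rmod R M \<phi> \<in> lFinX R L" and N: "rsubmodule (UP R) (poly_rmod R M \<phi>) N"
  shows "ent R L M \<phi>
    = ent R L (M\<lparr>carrier := N\<rparr>) (restrict \<phi> N) + ent R L (quot_rmod M N) (quot_map M N \<phi>)"
proof -
  interpret length_rmodule R M L by (rule length_rmoduleI[OF M])
  let ?P = "poly_rmod R M \<phi>"
  note PD = lFinXD[OF lf]
  have sel: "carrier ?P = carrier M" "\<zero>\<^bsub>?P\<^esub> = \<zero>\<^bsub>M\<^esub>" "x \<oplus>\<^bsub>?P\<^esub> y = x \<oplus>\<^bsub>M\<^esub> y" for x y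
    by (simp_all add: poly_rmod_def)
  note base = poly_rmod_base[OF \<phi>]
  interpret B: length_rmodule R "base_rmod R ?P" L by (rule PD)
  \<comment> \<open>\<open>M\<close> and the base module of \<open>?P\<close> need not be equal as
    records, since their actions are only known to agree on the carriers. Local finiteness is
    therefore transported along the identity map.\<close>
  have i: "rmodule_hom R M (base_rmod R ?P) (\<lambda>x. x)"
    using base(1) by (intro rmodule_hom.intro rmodule_hom_axioms.intro M B.rmodule_axioms)
      (simp add: rmod_hom_def sel)
  have "locally_finite R L M"
    unfolding locally_finite_def
  proof (intro allI impI)
    fix F assume F: "fg_submodule R M F"
    have "L (base_rmod R ?P\<lparr>carrier := F\<rparr>) = len F"
      using len_inj_image[OF i _ fg_rsubmodule[OF F]] by simp
    moreover have "fg_submodule R (base_rmod R ?P) F"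
      using rmodule_hom.fg_submodule_image[OF i F] by simp
    ultimately show "len F < \<infinity>" using PD(3) unfolding locally_finite_def by metis
  qed
  moreover have Ns: "rsubmodule R M N"
  proof -
    note D = B.rsubmoduleD[OF rsubmodule_base_rmod(1)[OF PD(1) N]]
    have c: "x \<in> carrier M" if "x \<in> N" for x using D(1) that by (auto simp: sel)
    show ?thesis
    proof (rule rsubmoduleI)
      show "x \<cdot>\<^bsub>M\<^esub> r \<in> N" if "x \<in> N" "r \<in> carrier R" for x r
        using D(4)[OF that] base(1)[OF c[OF that(1)] that(2)] by simp
    qed (use D(1-3) in \<open>simp_all add: sel\<close>)
  qed
  moreover have inv: "\<phi> ` N \<subseteq> N"
    using rsubmodule_base_rmod(2)[OF PD(1) N] base(2) rsubmoduleD(1)[OF Ns]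
    by (metis (no_types, lifting) image_cong subsetD)
  ultimately have "endo_extension R M L (M\<lparr>carrier := N\<rparr>) (quot_rmod M N) (\<lambda>x. x) (coset_rep M N)
      (restrict \<phi> N) \<phi> (quot_map M N \<phi>)"
    using quot_map_coset_rep[OF Ns \<phi> inv]
    by (intro endo_extension.intro endo_extension_axioms.intro length_rmodule_axioms \<phi> restrict_hom
        quot_map_hom rsubmodule_rmodule quot_rmod_is_rmodule short_exact_quot_rmod) simp_all
  then show ?thesis by (rule endo_extension.ent_additive)
qed

end

theorem theorem5p7:
  fixes R :: "('r, 'k) ring_scheme"
    and L :: "('r, 'm) rmod \<Rightarrow> ennreal"
  assumes "ring R"
    and "length_function R (Right_Mod R) L"
  shows "(\<forall>M\<in>Right_Mod R. \<forall>\<phi>\<in>rmod_hom R M M. poly_rmod R M \<phi> \<in> lFinX R L \<longrightarrow>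
            (\<forall>N. rsubmodule (UP R) (poly_rmod R M \<phi>) N \<longrightarrow>
              ent R L M \<phi> =
                ent R L (M\<lparr>carrier := N\<rparr>) (restrict \<phi> N)
                + ent R L (quot_rmod M N) (quot_map M N \<phi>)))
         \<and> length_function (UP R) (lFinX R L) (entX R L)"
proof -
  interpret ring_length_function R L
    by (intro ring_length_function.intro ring_length_function_axioms.intro assms)
  show ?thesis
    using ent_additive_quotient length_function_entX by (simp add: Right_Mod_def)
qed

end
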